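(* Let $\mu\in\mathcal M(E)$ and $a<I(\mu)$. Then there exist a $\tau$-neighborhood $N_\mu$ of $\mu$ and an $m$-thin set $N$ such that for every $x\notin N$, $$\limsup_{t\to\infty}\frac1t\log P^x(L_t\in N_\mu)\le-a.$$ Furthermore, if a capacity is given as described in the context and satisfies the capacity condition there, then $N$ has capacity $0$.
   Context: Setting. $E$ is a topological Lusin space (Hausdorff, continuous bijective image of a Polish space); $\mathcal B(E)$ its Borel $\sigma$-algebra, assumed generated by the continuous real functions. $m$ is a $\sigma$-finite measure on $E$ with $m(E)>0$. $B_b(E)$ ($B_b^+(E)$): bounded (bounded nonnegative) measurable functions; $\mathcal M(E)$: probability measures on $E$. $p_t(x,\cdot)$, $t\ge0$, is a transition probability function (probability measures, jointly measurable in $(t,x)$, $p_0(x,A)=1_A(x)$); $p_tf(x)=\int f\,dp_t(x,\cdot)$. There is a strongly continuous semigroup $(T_t)$ on $L_2(m)$ with $p_tf$ a representative of $T_tf$ for every bounded measurable $f$ with $\int f^2dm<\infty$. There is a progressively measurable Markov process $(\Omega,\mathcal F^o_t,X_t,P^x)$ with transition function $p_t$, $P^x(X_0=x)=1$, infinite lifetime. Definitions. $D=\{u\in B_b^+(E):\int u\,dm<\infty\}$. $D_1$: functions $v=\frac1t\int_0^tp_s\tilde u\,ds$, $\tilde u=p_\eta u$, $u\in D$, $t>0$, $\eta\ge0$, with $\hat Lv=\frac1t(p_t\tilde u-\tilde u)$. $\hat I(\mu)=-\inf\{\int\frac{\hat Lv}{v+\varepsilon}d\mu:v\in D_1,\varepsilon>0\}$,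 and $I(\mu)=\hat I(\mu)$ if $\mu\ll m$, $I(\mu)=+\infty$ otherwise. $L_t(\omega,A)=\frac1t\int_0^t1_A(X_s(\omega))ds$. A $\tau$-neighborhood of $\mu$ is a set $\{\nu\in\mathcal M(E):|\int f_jd\nu-\int f_jd\mu|<\varepsilon,1\le j\le r\}$, $\varepsilon>0$, $f_j\in B_b(E)$. $Rf(x)=\int_0^\infty e^{-t}p_tf(x)dt$. A set $N\in\mathcal B(E)$ is $m$-thin if there is $B\in\mathcal B(E)$ with $m(B)=0$ and $N\subset\{x:R1_B(x)>0\}$. Capacity: a monotone set function on $\mathcal B(E)$ (e.g. the capacity of the potential theory of the process) such that countable unions of sets of capacity $0$ have capacity $0$. Capacity condition: if $f=0$ $m$-a.e. and $t>0$, then $p_tf=0$ except on a set of capacity $0$. *)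

theory Defs
  imports "HOL-Probability.Probability"
begin

text \<open>A Lusin space: Hausdorff, and a continuous bijective image of a Polish space.
  The Polish space is carried on a subset of the same type (it has the same
  cardinality as E, being in bijection with it).\<close>
definition lusin_topology :: "'a topology \<Rightarrow> bool" where
  "lusin_topology X \<longleftrightarrow> Hausdorff_space X \<and>
     (\<exists>(Y::'a topology) f. completely_metrizable_space Y \<and> separable_space Y \<and>
        continuous_map Y X f \<and> bij_betw f (topspace Y) (topspace X))"

definition transition_function :: "(real \<Rightarrow> 'a::topological_space \<Rightarrow> 'a measure) \<Rightarrow> bool" where
  "transition_function p \<longleftrightarrow>
     (\<forall>t\<ge>0. \<forall>x. prob_space (p t x) \<and> sets (p t x) = sets borel) \<and>
     (\<forall>A\<in>sets borel. (\<lambda>(t,x). measure (p t x) A)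
          \<in> borel_measurable (restrict_space borel {0..} \<Otimes>\<^sub>M borel)) \<and>
     (\<forall>x. p 0 x = return borel x)"

definition trans_op :: "(real \<Rightarrow> 'a \<Rightarrow> 'a measure) \<Rightarrow> real \<Rightarrow> ('a \<Rightarrow> real) \<Rightarrow> 'a \<Rightarrow> real" where
  "trans_op p t f x = (\<integral>y. f y \<partial>(p t x))"

text \<open>L2(m) is represented by its square-integrable measurable representatives; the
  operators T t act on representatives and all identities hold m-a.e.\<close>
definition L2_set :: "'a measure \<Rightarrow> ('a \<Rightarrow> real) set" where
  "L2_set m = {f. f \<in> borel_measurable m \<and> integrable m (\<lambda>x. (f x)\<^sup>2)}"

definition strongly_continuous_L2_semigroup ::
    "'a measure \<Rightarrow> (real \<Rightarrow> ('a \<Rightarrow> real) \<Rightarrow> ('a \<Rightarrow> real)) \<Rightarrow> bool" where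
  "strongly_continuous_L2_semigroup m T \<longleftrightarrow>
     (\<forall>t\<ge>0. \<forall>f\<in>L2_set m. T t f \<in> L2_set m) \<and>
     (\<forall>t\<ge>0. \<forall>f\<in>L2_set m. \<forall>g\<in>L2_set m.
         (AE x in m. f x = g x) \<longrightarrow> (AE x in m. T t f x = T t g x)) \<and>
     (\<forall>t\<ge>0. \<forall>f\<in>L2_set m. \<forall>g\<in>L2_set m. \<forall>c::real.
         AE x in m. T t (\<lambda>y. f y + c * g y) x = T t f x + c * T t g x) \<and>
     (\<forall>t\<ge>0. \<exists>C. \<forall>f\<in>L2_set m. (\<integral>x. (T t f x)\<^sup>2 \<partial>m) \<le> C * (\<integral>x. (f x)\<^sup>2 \<partial>m)) \<and>
     (\<forall>f\<in>L2_set m. AE x in m. T 0 f x = f x) \<and>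
     (\<forall>s\<ge>0. \<forall>t\<ge>0. \<forall>f\<in>L2_set m. AE x in m. T (s + t) f x = T s (T t f) x) \<and>
     (\<forall>f\<in>L2_set m. ((\<lambda>t. \<integral>x. (T t f x - f x)\<^sup>2 \<partial>m) \<longlongrightarrow> 0) (at_right 0))"

definition semigroup_represented ::
    "'a::topological_space measure \<Rightarrow> (real \<Rightarrow> 'a \<Rightarrow> 'a measure)
       \<Rightarrow> (real \<Rightarrow> ('a \<Rightarrow> real) \<Rightarrow> ('a \<Rightarrow> real)) \<Rightarrow> bool" where
  "semigroup_represented m p T \<longleftrightarrow>
     (\<forall>t\<ge>0. \<forall>f. f \<in> borel_measurable borel \<and> bounded (range f) \<and> integrable m (\<lambda>x. (f x)\<^sup>2)
         \<longrightarrow> (AE x in m. trans_op p t f x = T t f x))"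

definition natural_filtration :: "'w set \<Rightarrow> (real \<Rightarrow> 'w \<Rightarrow> 'a::topological_space) \<Rightarrow> real \<Rightarrow> 'w set set" where
  "natural_filtration \<Omega> X t =
     sigma_sets \<Omega> {X r -` A \<inter> \<Omega> | r A. 0 \<le> r \<and> r \<le> t \<and> A \<in> sets borel}"

text \<open>Progressively measurable Markov process with transition function p, started at x
  under P x; the lifetime is infinite since X takes values in E at all times.\<close>
definition markov_process ::
    "'w measure \<Rightarrow> (real \<Rightarrow> 'w \<Rightarrow> 'a::topological_space) \<Rightarrow> ('a \<Rightarrow> 'w measure)
       \<Rightarrow> (real \<Rightarrow> 'a \<Rightarrow> 'a measure) \<Rightarrow> bool" where
  "markov_process M X P p \<longleftrightarrow>
     (\<forall>t\<ge>0. X t \<in> borel_measurable M) \<and>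
     (\<forall>x. prob_space (P x) \<and> sets (P x) = sets M) \<and>
     (\<forall>t\<ge>0. (\<lambda>(s,\<omega>). X s \<omega>) \<in> borel_measurable
          (restrict_space borel {0..t} \<Otimes>\<^sub>M sigma (space M) (natural_filtration (space M) X t))) \<and>
     (\<forall>x. measure (P x) {\<omega>\<in>space M. X 0 \<omega> = x} = 1) \<and>
     (\<forall>x. \<forall>s\<ge>0. \<forall>t\<ge>0. \<forall>B\<in>natural_filtration (space M) X s. \<forall>A\<in>sets borel.
        measure (P x) (B \<inter> {\<omega>\<in>space M. X (s + t) \<omega> \<in> A})
          = (\<integral>\<omega>. indicator B \<omega> * measure (p t (X s \<omega>)) A \<partial>(P x)))"

definition D_set :: "'a::topological_space measure \<Rightarrow> ('a \<Rightarrow> real) set" where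
  "D_set m = {u. u \<in> borel_measurable borel \<and> (\<forall>x. 0 \<le> u x) \<and> bounded (range u) \<and> integrable m u}"

text \<open>Pairs \<open>(v, \<hat>L v)\<close> with \<open>v \<in> D\<^sub>1\<close>, over all representations \<open>(u, t, \<eta>)\<close>.\<close>
definition D1_pairs :: "(real \<Rightarrow> 'a \<Rightarrow> 'a measure) \<Rightarrow> 'a::topological_space measure
      \<Rightarrow> (('a \<Rightarrow> real) \<times> ('a \<Rightarrow> real)) set" where
  "D1_pairs p m =
     {((\<lambda>x. (1 / t) * (LBINT s=0..t. trans_op p s (trans_op p \<eta> u) x)),
       (\<lambda>x. (1 / t) * (trans_op p t (trans_op p \<eta> u) x - trans_op p \<eta> u x)))
      | u t \<eta>. u \<in> D_set m \<and> t > 0 \<and> \<eta> \<ge> 0}"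

definition I_hat :: "(real \<Rightarrow> 'a \<Rightarrow> 'a measure) \<Rightarrow> 'a::topological_space measure
      \<Rightarrow> 'a measure \<Rightarrow> ereal" where
  "I_hat p m \<mu> = - Inf {ereal (\<integral>x. Lv x / (v x + \<epsilon>) \<partial>\<mu>) | v Lv \<epsilon>.
                          (v, Lv) \<in> D1_pairs p m \<and> \<epsilon> > 0}"

definition I_rate :: "(real \<Rightarrow> 'a \<Rightarrow> 'a measure) \<Rightarrow> 'a::topological_space measure
      \<Rightarrow> 'a measure \<Rightarrow> ereal" where
  "I_rate p m \<mu> = (if absolutely_continuous m \<mu> then I_hat p m \<mu> else \<infinity>)"

text \<open>\<open>L_t(\<omega>,A) = (1/t) \<integral>_0^t 1_A(X_s \<omega>) ds\<close>, as the image of the uniform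
  distribution on [0,t] under \<open>s \<mapsto> X_s \<omega>\<close>.\<close>
definition occupation_measure :: "(real \<Rightarrow> 'w \<Rightarrow> 'a::topological_space) \<Rightarrow> real \<Rightarrow> 'w \<Rightarrow> 'a measure" where
  "occupation_measure X t \<omega> = distr (uniform_measure lborel {0..t}) borel (\<lambda>s. X s \<omega>)"

definition tau_nbhd :: "'a::topological_space measure \<Rightarrow> 'a measure set \<Rightarrow> bool" where
  "tau_nbhd \<mu> N \<longleftrightarrow>
     (\<exists>\<epsilon>>0. \<exists>(r::nat) (fs :: nat \<Rightarrow> 'a \<Rightarrow> real).
        (\<forall>j\<in>{1..r}. fs j \<in> borel_measurable borel \<and> bounded (range (fs j))) \<and>
        N = {\<nu>. prob_space \<nu> \<and> sets \<nu> = sets borel \<and>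
               (\<forall>j\<in>{1..r}. \<bar>(\<integral>x. fs j x \<partial>\<nu>) - (\<integral>x. fs j x \<partial>\<mu>)\<bar> < \<epsilon>)})"

definition elog :: "real \<Rightarrow> ereal" where
  "elog x = (if x = 0 then - \<infinity> else ereal (ln x))"

definition resolvent :: "(real \<Rightarrow> 'a \<Rightarrow> 'a measure) \<Rightarrow> ('a \<Rightarrow> real) \<Rightarrow> 'a \<Rightarrow> real" where
  "resolvent p f x = (LBINT t:{0..}. exp (- t) * trans_op p t f x)"

definition m_thin :: "(real \<Rightarrow> 'a \<Rightarrow> 'a measure) \<Rightarrow> 'a::topological_space measure \<Rightarrow> 'a set \<Rightarrow> bool" where
  "m_thin p m N \<longleftrightarrow> N \<in> sets borel \<and>
     (\<exists>B\<in>sets borel. emeasure m B = 0 \<and> N \<subseteq> {x. resolvent p (indicator B) x > 0})"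

definition capacity :: "('a::topological_space set \<Rightarrow> ennreal) \<Rightarrow> bool" where
  "capacity cap \<longleftrightarrow>
     (\<forall>A\<in>sets borel. \<forall>B\<in>sets borel. A \<subseteq> B \<longrightarrow> cap A \<le> cap B) \<and>
     (\<forall>As :: nat \<Rightarrow> 'a set. (\<forall>i. As i \<in> sets borel \<and> cap (As i) = 0) \<longrightarrow> cap (\<Union>i. As i) = 0)"

definition capacity_condition :: "(real \<Rightarrow> 'a \<Rightarrow> 'a measure) \<Rightarrow> 'a::topological_space measure
      \<Rightarrow> ('a set \<Rightarrow> ennreal) \<Rightarrow> bool" where
  "capacity_condition p m cap \<longleftrightarrow>
     (\<forall>f t. f \<in> borel_measurable borel \<and> bounded (range f) \<and> (AE x in m. f x = 0) \<and> t > 0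
        \<longrightarrow> (\<exists>Z\<in>sets borel. cap Z = 0 \<and> (\<forall>x. x \<notin> Z \<longrightarrow> trans_op p t f x = 0)))"

end

theory Submission
  imports Defs "HOL-Real_Asymp.Real_Asymp"
begin

text \<open>
  If \<open>\<mu>\<close> is not absolutely continuous, some \<open>B\<close> has \<open>m(B) = 0 < \<mu>(B)\<close>; a \<open>\<tau>\<close>-neighborhood forces
  \<open>L_t(B) > 0\<close>, and off the \<open>m\<close>-thin set \<open>{R 1_B > 0}\<close> the process almost surely spends no time
  in \<open>B\<close>. If \<open>\<mu>\<close> is absolutely continuous, take \<open>v \<in> D\<^sub>1\<close> and \<open>\<epsilon> > 0\<close> with
  \<open>a < \<integral>V d\<mu>\<close> for \<open>V = -\<hat>Lv / (v + \<epsilon>)\<close>. The identity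
  \<open>p_h v - v = \<integral>_0^h p_r \<hat>Lv dr\<close> holds at every point, so the Feynman-Kac formula
  \<open>E^x[exp(\<integral>_0^t V(X_s) ds) (v + \<epsilon>)(X_t)] = v(x) + \<epsilon>\<close> holds for every starting point, and the
  exponential Chebyshev inequality gives the bound with an empty exceptional set.
  For the capacity: \<open>R 1_B = 0\<close> \<open>m\<close>-a.e., hence \<open>p_h R 1_B = 0\<close> off a set of capacity \<open>0\<close> for each
  \<open>h = 1/n\<close>, and these countably many conditions already imply \<open>R 1_B(x) = 0\<close>.
\<close>

subsection \<open>Integration on compact intervals\<close>

lemma set_integral_bound:
  fixes f :: "real \<Rightarrow> real"
  assumes "f \<in> borel_measurable borel" "\<And>s. s \<in> {a..b} \<Longrightarrow> \<bar>f s\<bar> \<le> C" "a \<le> b"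
  shows "set_integrable lborel {a..b} f" "\<bar>LBINT s:{a..b}. f s\<bar> \<le> C * (b - a)"
proof -
  have 1: "integrable lborel (\<lambda>s. indicator {a..b} s *\<^sub>R f s)"
    by (rule integrableI_bounded_set_indicator[where B=C]) (use assms in auto)
  then show "set_integrable lborel {a..b} f" by (simp add: set_integrable_def)
  have "\<bar>LBINT s:{a..b}. f s\<bar> \<le> (\<integral>s. norm (indicator {a..b} s *\<^sub>R f s) \<partial>lborel)"
    unfolding set_lebesgue_integral_def using integral_norm_bound by (metis real_norm_def)
  also have "\<dots> \<le> (\<integral>s. indicator {a..b} s * C \<partial>lborel)"
    by (rule integral_mono) (use 1 assms in \<open>auto split: split_indicator\<close>)
  also have "\<dots> = C * (b - a)" using assms(3) by simp
  finally show "\<bar>LBINT s:{a..b}. f s\<bar> \<le> C * (b - a)" .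
qed

lemma set_integral_shift:
  fixes f :: "real \<Rightarrow> real"
  shows "(LBINT s:{a..b}. f (s + c)) = (LBINT s:{a + c..b + c}. f s)"
  unfolding set_lebesgue_integral_def
  by (subst (2) lborel_integral_real_affine[where c=1 and t=c])
     (auto intro!: Bochner_Integration.integral_cong simp: algebra_simps split: split_indicator)

lemma set_integral_adjacent:
  fixes f :: "real \<Rightarrow> real"
  assumes "f \<in> borel_measurable borel" "\<And>s. s \<in> {a..c} \<Longrightarrow> \<bar>f s\<bar> \<le> C" "a \<le> b" "b \<le> c"
  shows "(LBINT s:{a..c}. f s) = (LBINT s:{a..b}. f s) + (LBINT s:{b..c}. f s)"
proof -
  have "set_integrable lborel {a..c} f"
    by (rule set_integral_bound(1)[where C=C]) (use assms in auto)
  then have "(LBINT s=a..b. f s) + (LBINT s=b..c. f s) = (LBINT s=a..c. f s)"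
    using assms(3,4)
    by (intro interval_integral_sum)
       (auto simp: min_def max_def interval_lebesgue_integrable_def einterval_iff
         intro: set_integrable_subset)
  then show ?thesis using assms(3,4) by (simp add: interval_integral_Icc)
qed

text \<open>The truncated integrand is bounded and lives on a rectangle of finite product measure,
  so it is integrable there. The bound on \<open>f\<close> is asked for only at times in
  \<open>{a..b}\<close>.\<close>

lemma (in prob_space) set_integral_Fubini:
  fixes f :: "real \<Rightarrow> 'a \<Rightarrow> real"
  assumes [measurable]: "case_prod f \<in> borel_measurable (lborel \<Otimes>\<^sub>M M)"
    and bd: "\<And>s x. s \<in> {a..b} \<Longrightarrow> x \<in> space M \<Longrightarrow> \<bar>f s x\<bar> \<le> C"
  shows "(\<integral>x. (LBINT s:{a..b}. f s x) \<partial>M) = (LBINT s:{a..b}. (\<integral>x. f s x \<partial>M))"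
proof -
  have fin: "emeasure (lborel \<Otimes>\<^sub>M M) ({a..b} \<times> space M) < \<infinity>"
    by (subst emeasure_pair_measure_Times) (auto simp: emeasure_space_1 emeasure_lborel_Icc_eq)
  interpret pair_sigma_finite lborel M
    by (simp add: pair_sigma_finite_def lborel.sigma_finite_measure_axioms sigma_finite_measure_axioms)
  have "integrable (lborel \<Otimes>\<^sub>M M) (\<lambda>(s,x). indicator {a..b} s *\<^sub>R f s x)"
  proof (rule integrableI_bounded_set[where A="{a..b} \<times> space M" and B=C])
    show "emeasure (lborel \<Otimes>\<^sub>M M) ({a..b} \<times> space M) < \<infinity>" by (rule fin)
  qed (use bd in \<open>auto simp: space_pair_measure indicator_def intro!: AE_I2 split: if_splits\<close>)
  from Fubini_integral[OF this] show ?thesis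
    unfolding set_lebesgue_integral_def by simp
qed

text \<open>For a non-measurable map, \<^const>\<open>distr\<close> is a junk measure (the push-forward is in general
  not additive). The paths of the process may be non-measurable on the negative half-line, so an
  occupation measure may be such a junk value; it is then not a probability measure.\<close>

lemma prob_space_distr_imp_measurable:
  assumes "prob_space (distr Q N f)" and "f \<in> space Q \<rightarrow> space N"
  shows "f \<in> Q \<rightarrow>\<^sub>M N"
proof (rule measurableI)
  interpret D: prob_space "distr Q N f" by fact
  let ?\<mu> = "\<lambda>A. emeasure Q (f -` A \<inter> space Q)"
  have eq: "emeasure (distr Q N f) A = (if measure_space (space N) (sets N) ?\<mu> then ?\<mu> A else 0)"
    if "A \<in> sets N" for A
    unfolding distr_def
    by (subst emeasure_measure_of_conv)
       (use that in \<open>auto simp: sets.sigma_sets_eq sets.space_closed\<close>)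
  fix A assume A: "A \<in> sets N"
  have "emeasure (distr Q N f) (space N) = 1" using D.emeasure_space_1 by simp
  then have ms: "measure_space (space N) (sets N) ?\<mu>"
    using eq[of "space N"] by (auto split: if_splits)
  \<comment> \<open>A non-measurable set gets \<open>emeasure\<close> 0. As the preimages of
    \<open>A\<close> and of its complement have masses adding up to 1, at least one of them is
    measurable, and then so is the other.\<close>
  have "emeasure (distr Q N f) A + emeasure (distr Q N f) (space N - A) = 1"
    using A D.emeasure_space_1 by (subst plus_emeasure) (auto simp: Un_absorb1 sets.sets_into_space)
  then have "?\<mu> A + ?\<mu> (space N - A) = 1" using A ms by (simp add: eq sets.compl_sets)
  then have "f -` A \<inter> space Q \<in> sets Q \<or> f -` (space N - A) \<inter> space Q \<in> sets Q"
    by (metis add_0 emeasure_notin_sets zero_neq_one)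
  moreover have "f -` A \<inter> space Q = space Q - (f -` (space N - A) \<inter> space Q)"
    using assms(2) by auto
  ultimately show "f -` A \<inter> space Q \<in> sets Q" by (metis sets.compl_sets)
qed (use assms(2) in auto)

text \<open>Cut \<open>{0..t}\<close> into \<open>n\<close> equal steps: the increments add up to at
  most \<open>C * t\<^sup>2 / n\<close>, which tends to 0. Neither continuity nor differentiability
  of \<open>f\<close> enters.\<close>

lemma constant_if_quadratic_increments:
  fixes f :: "real \<Rightarrow> real"
  assumes "0 \<le> t"
    and inc: "\<And>s h. 0 \<le> s \<Longrightarrow> 0 \<le> h \<Longrightarrow> h \<le> \<delta> \<Longrightarrow> s + h \<le> t \<Longrightarrow> \<bar>f (s + h) - f s\<bar> \<le> C * h\<^sup>2"
    and "\<delta> > 0"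
  shows "f t = f 0"
proof -
  have "((\<lambda>n. C * t\<^sup>2 / real n) \<longlongrightarrow> 0) sequentially" by real_asymp
  moreover have "eventually (\<lambda>n. \<bar>f t - f 0\<bar> \<le> C * t\<^sup>2 / real n) sequentially"
  proof -
    have "((\<lambda>n. t / real n) \<longlongrightarrow> 0) sequentially" by real_asymp
    then have "eventually (\<lambda>n. t / real n < \<delta>) sequentially"
      using \<open>\<delta> > 0\<close> by (auto dest: order_tendstoD(2))
    then show ?thesis using eventually_gt_at_top[of 0]
    proof eventually_elim
      case (elim n)
      let ?h = "t / real n"
      have "\<bar>f (real k * ?h) - f 0\<bar> \<le> real k * (C * ?h\<^sup>2)" if "k \<le> n" for k
        using that
      proof (induction k)
        case (Suc k)
        have "real (Suc k) * ?h \<le> real n * ?h"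
          using Suc.prems \<open>0 \<le> t\<close> by (intro mult_right_mono) auto
        then have "real k * ?h + ?h \<le> t" using elim by (simp add: field_simps)
        then have "\<bar>f (real k * ?h + ?h) - f (real k * ?h)\<bar> \<le> C * ?h\<^sup>2"
          using elim \<open>0 \<le> t\<close> by (intro inc) auto
        moreover have "\<bar>f (real k * ?h) - f 0\<bar> \<le> real k * (C * ?h\<^sup>2)"
          using Suc by simp
        moreover have "real (Suc k) * ?h = real k * ?h + ?h"
          and "real (Suc k) * (C * ?h\<^sup>2) = real k * (C * ?h\<^sup>2) + C * ?h\<^sup>2"
          using elim by (simp_all add: field_simps)
        ultimately show ?case by (simp only: abs_le_iff) linarith
      qed simp
      from this[of n] elim show ?case by (simp add: power2_eq_square field_simps)
    qed
  qed
  ultimately have "\<bar>f t - f 0\<bar> \<le> 0"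
    by (intro tendsto_lowerbound) auto
  then show ?thesis by simp
qed

text \<open>The upper estimate comes from \<open>1 - D \<le> exp (- D)\<close>, that is,
  \<open>(1 - D) * exp D \<le> 1\<close>, compared with \<open>(1 - D) * (1 + D + 2 * D\<^sup>2) = 1
  + D\<^sup>2 * (1 - 2 * D) \<ge> 1\<close>.\<close>

lemma abs_exp_minus_one_minus_le:
  fixes D :: real
  assumes "\<bar>D\<bar> \<le> 1/2"
  shows "\<bar>exp D - 1 - D\<bar> \<le> 2 * D\<^sup>2"
proof -
  have 1: "1 + D \<le> exp D" by (rule exp_ge_add_one_self)
  have "(1 - D) * exp D \<le> exp (- D) * exp D"
    using exp_ge_add_one_self[of "- D"] by (intro mult_right_mono) auto
  then have 2: "(1 - D) * exp D \<le> 1" by (simp add: exp_minus)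
  have "1 \<le> (1 - D) * (1 + D + 2 * D\<^sup>2)"
  proof -
    have "(1 - D) * (1 + D + 2 * D\<^sup>2) = 1 + D\<^sup>2 * (1 - 2 * D)"
      by (simp add: algebra_simps power2_eq_square)
    then show ?thesis using assms by (simp add: abs_le_iff)
  qed
  with 2 have "(1 - D) * exp D \<le> (1 - D) * (1 + D + 2 * D\<^sup>2)" by linarith
  then have "exp D \<le> 1 + D + 2 * D\<^sup>2" using assms by (subst (asm) mult_le_cancel_left_pos) auto
  with 1 zero_le_power2[of D] show ?thesis by linarith
qed

lemma (in prob_space) bounded_expectation:
  fixes Z :: "'a \<Rightarrow> real"
  assumes "Z \<in> borel_measurable M" "\<And>x. x \<in> space M \<Longrightarrow> \<bar>Z x\<bar> \<le> B"
  shows "integrable M Z" "\<bar>expectation Z\<bar> \<le> B"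
proof -
  show 1: "integrable M Z"
    by (rule integrable_const_bound[where B=B]) (use assms in auto)
  have "\<bar>expectation Z\<bar> \<le> expectation (\<lambda>x. \<bar>Z x\<bar>)" by (rule integral_abs_bound)
  also have "\<dots> \<le> expectation (\<lambda>_. B)" using 1 assms(2) by (intro integral_mono) auto
  finally show "\<bar>expectation Z\<bar> \<le> B" by (simp add: prob_space)
qed

text \<open>The prefactor \<open>c\<close> contributes only \<open>ln c / t\<close>, which vanishes
  in the limit. Times with \<open>f t = 0\<close> are treated apart, since \<open>elog\<close> is
  minus infinity there.\<close>

lemma Limsup_elog_le:
  assumes "0 < c" and f: "\<And>t. 0 < t \<Longrightarrow> 0 \<le> f t \<and> f t \<le> exp (- a * t) * c"
  shows "Limsup at_top (\<lambda>t::real. ereal (1 / t) * elog (f t)) \<le> ereal (- a)"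
proof -
  have "Limsup at_top (\<lambda>t. ereal (1 / t) * elog (f t)) \<le> Limsup at_top (\<lambda>t. ereal (- a + ln c / t))"
  proof (rule Limsup_mono)
    show "\<forall>\<^sub>F t in at_top. ereal (1 / t) * elog (f t) \<le> ereal (- a + ln c / t)"
      using eventually_gt_at_top[of 0]
    proof eventually_elim
      case (elim t)
      show ?case
      proof (cases "f t = 0")
        case True
        then show ?thesis using elim by (simp add: elog_def)
      next
        case False
        then have "ln (f t) \<le> ln (exp (- a * t) * c)" using f[OF elim] by (subst ln_le_cancel_iff) auto
        also have "\<dots> = - a * t + ln c" using \<open>0 < c\<close> by (simp add: ln_mult)
        finally have "(1 / t) * ln (f t) \<le> (1 / t) * (- a * t + ln c)"
          using elim by (intro mult_left_mono) auto
        also have "\<dots> = - a + ln c / t" using elim by (simp add: field_simps)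
        finally show ?thesis using False by (simp add: elog_def)
      qed
    qed
  qed
  also have "\<dots> = ereal (- a)"
  proof (rule lim_imp_Limsup)
    have "((\<lambda>t. - a + ln c / t) \<longlongrightarrow> - a) at_top" by real_asymp
    then show "((\<lambda>t. ereal (- a + ln c / t)) \<longlongrightarrow> ereal (- a)) at_top" by simp
  qed simp
  finally show ?thesis .
qed

subsection \<open>Markov processes and their transition semigroup\<close>

locale markov_setting =
  fixes p :: "real \<Rightarrow> 'a::topological_space \<Rightarrow> 'a measure"
    and M :: "'w measure"
    and X :: "real \<Rightarrow> 'w \<Rightarrow> 'a"
    and P :: "'a \<Rightarrow> 'w measure"
  assumes trans: "transition_function p"
    and markov: "markov_process M X P p"
begin

text \<open>Nothing is known about \<open>p t\<close> and \<open>X t\<close> for \<open>t < 0\<close>; freezing them at time \<open>0\<close> gives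
  functions that are jointly measurable on the whole line.\<close>

definition q :: "real \<Rightarrow> ('a \<Rightarrow> real) \<Rightarrow> 'a \<Rightarrow> real" where
  "q t = trans_op p (max 0 t)"

definition Y :: "real \<Rightarrow> 'w \<Rightarrow> 'a" where
  "Y t = X (max 0 t)"

definition F :: "real \<Rightarrow> 'w measure" where
  "F t = sigma (space M) (natural_filtration (space M) X t)"

lemma prob_space_p: "0 \<le> t \<Longrightarrow> prob_space (p t x)"
  and sets_p [measurable_cong]: "0 \<le> t \<Longrightarrow> sets (p t x) = sets borel"
  using trans by (auto simp: transition_function_def)

lemma prob_space_P: "prob_space (P x)"
  and sets_P [measurable_cong]: "sets (P x) = sets M"
  using markov by (auto simp: markov_process_def)

lemma space_P: "space (P x) = space M"
  using sets_eq_imp_space_eq[OF sets_P] .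

text \<open>In this form the library facts on \<open>bind\<close> and on integrals against kernels
  apply. The definition speaks of \<open>measure\<close>; for probability measures this transfers to
  \<open>emeasure\<close>.\<close>

lemma transition_kernel: "(\<lambda>(t,x). p t x) \<in> restrict_space borel {0..} \<Otimes>\<^sub>M borel \<rightarrow>\<^sub>M subprob_algebra borel"
proof (rule measurable_subprob_algebra)
  fix A :: "'a set" assume A: "A \<in> sets borel"
  have "(\<lambda>z. ennreal (measure (case z of (t,x) \<Rightarrow> p t x) A))
      \<in> borel_measurable (restrict_space borel {0..} \<Otimes>\<^sub>M borel)"
    using trans A by (auto simp: transition_function_def case_prod_unfold)
  then show "(\<lambda>z. emeasure (case z of (t,x) \<Rightarrow> p t x) A)
      \<in> borel_measurable (restrict_space borel {0..} \<Otimes>\<^sub>M borel)"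
    by (rule measurable_cong[THEN iffD1, rotated])
       (auto simp: space_pair_measure space_restrict_space
         intro!: finite_measure.emeasure_eq_measure[symmetric] prob_space.finite_measure prob_space_p)
qed (auto simp: space_pair_measure space_restrict_space sets_p intro!: prob_space_imp_subprob_space prob_space_p)

lemma transition_kernel_frozen: "(\<lambda>(t,x). p (max 0 t) x) \<in> borel \<Otimes>\<^sub>M borel \<rightarrow>\<^sub>M subprob_algebra borel"
proof -
  have "(\<lambda>(t,x::'a). (max 0 t, x)) \<in> (borel :: real measure) \<Otimes>\<^sub>M borel \<rightarrow>\<^sub>M restrict_space borel {0..} \<Otimes>\<^sub>M borel"
    by (auto intro!: measurable_Pair measurable_restrict_space2 simp: case_prod_unfold)
  from measurable_compose[OF this transition_kernel] show ?thesis by (simp add: case_prod_unfold)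
qed

lemma transition_kernel_at: "0 \<le> t \<Longrightarrow> p t \<in> borel \<rightarrow>\<^sub>M subprob_algebra borel"
  using measurable_compose[OF _ transition_kernel_frozen, of "\<lambda>x. (t,x)" borel] by (simp add: max_def)

lemma q_measurable:
  assumes "f \<in> borel_measurable borel"
  shows "(\<lambda>z. q (fst z) f (snd z)) \<in> borel_measurable (borel \<Otimes>\<^sub>M borel)"
  using measurable_compose[OF transition_kernel_frozen integral_measurable_subprob_algebra[OF assms]]
  by (simp add: q_def trans_op_def case_prod_unfold)

lemma q_measurable_compose [measurable (raw)]:
  assumes "f \<in> borel_measurable borel" "g \<in> N \<rightarrow>\<^sub>M borel" "h \<in> N \<rightarrow>\<^sub>M borel"
  shows "(\<lambda>z. q (g z) f (h z)) \<in> borel_measurable N"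
  using measurable_compose[OF measurable_Pair[OF assms(2,3)] q_measurable[OF assms(1)]] by simp

lemma q_integrable:
  fixes C :: real
  assumes "f \<in> borel_measurable borel" "\<And>x. \<bar>f x\<bar> \<le> C"
  shows "integrable (p (max 0 t) x) f"
proof -
  interpret prob_space "p (max 0 t) x" by (rule prob_space_p) simp
  show ?thesis
    by (rule integrable_const_bound[where B=C])
       (use assms in \<open>simp_all add: measurable_cong_sets[OF sets_p refl]\<close>)
qed

lemma q_bound:
  assumes "f \<in> borel_measurable borel" "\<And>x. \<bar>f x\<bar> \<le> C"
  shows "\<bar>q t f x\<bar> \<le> C"
proof -
  interpret prob_space "p (max 0 t) x" by (rule prob_space_p) simp
  have "\<bar>q t f x\<bar> \<le> (\<integral>y. \<bar>f y\<bar> \<partial>p (max 0 t) x)"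
    unfolding q_def trans_op_def by (rule integral_abs_bound)
  also have "\<dots> \<le> (\<integral>y. C \<partial>p (max 0 t) x)"
    using q_integrable[OF assms] assms(2) by (intro integral_mono) auto
  finally show ?thesis by (simp add: prob_space)
qed

lemma q_add_const:
  assumes "f \<in> borel_measurable borel" "\<And>x. \<bar>f x\<bar> \<le> C"
  shows "q t (\<lambda>x. f x + c) x = q t f x + c"
proof -
  interpret prob_space "p (max 0 t) x" by (rule prob_space_p) simp
  show ?thesis unfolding q_def trans_op_def
    using q_integrable[OF assms] by (simp add: prob_space)
qed

section \<open>The natural filtration and progressive measurability\<close>

lemma natural_filtration_subset: "natural_filtration (space M) X t \<subseteq> sets M"
  unfolding natural_filtration_def
  using markov by (intro sets.sigma_sets_subset) (auto simp: markov_process_def intro: measurable_sets)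

lemma space_F [simp]: "space (F t) = space M"
  by (simp add: F_def space_measure_of_conv)

lemma sets_F: "sets (F t) = natural_filtration (space M) X t"
proof -
  have "natural_filtration (space M) X t \<subseteq> Pow (space M)"
    using natural_filtration_subset sets.space_closed by blast
  then show ?thesis
    unfolding F_def by (simp add: natural_filtration_def) (subst sigma_sets_sigma_sets_eq; auto)
qed

lemma subalgebra_F: "subalgebra M (F t)" "subalgebra (P x) (F t)"
  using natural_filtration_subset by (auto simp: subalgebra_def sets_F space_P sets_P)

lemma F_mono: "s \<le> t \<Longrightarrow> subalgebra (F t) (F s)"
  unfolding subalgebra_def sets_F natural_filtration_def space_F
  by (intro conjI sigma_sets_subseteq refl Collect_mono) (blast intro: order_trans)

lemma measurable_F_mono: "s \<le> t \<Longrightarrow> G \<in> F s \<rightarrow>\<^sub>M N \<Longrightarrow> G \<in> F t \<rightarrow>\<^sub>M N"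
  using F_mono by (rule measurable_from_subalg)

text \<open>Clamping the time to \<open>{0..t}\<close> turns measurability on the restricted
  interval into measurability on the whole line, still relative to the past
  \<open>F t\<close>.\<close>

lemma Y_progressive:
  assumes "0 \<le> t"
  shows "(\<lambda>(s,\<omega>). Y (min t s) \<omega>) \<in> lborel \<Otimes>\<^sub>M F t \<rightarrow>\<^sub>M borel"
proof -
  have X: "(\<lambda>(s,\<omega>). X s \<omega>) \<in> restrict_space borel {0..t} \<Otimes>\<^sub>M F t \<rightarrow>\<^sub>M borel"
    using markov assms by (auto simp: markov_process_def F_def)
  have "(\<lambda>(s,\<omega>). (max 0 (min t s), \<omega>)) \<in> lborel \<Otimes>\<^sub>M F t \<rightarrow>\<^sub>M restrict_space borel {0..t} \<Otimes>\<^sub>M F t"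
    using assms by (auto intro!: measurable_Pair measurable_restrict_space2 simp: case_prod_unfold)
  from measurable_compose[OF this X] show ?thesis
    by (simp add: Y_def case_prod_unfold)
qed

text \<open>On \<open>s \<le> n\<close> the clamped process with horizon \<open>n\<close> equals
  \<open>Y\<close>, and these strips exhaust the product space as \<open>n\<close> grows.\<close>

lemma Y_joint: "(\<lambda>(s,\<omega>). Y s \<omega>) \<in> lborel \<Otimes>\<^sub>M M \<rightarrow>\<^sub>M borel"
proof (rule measurableI)
  fix A :: "'a set" assume A: "A \<in> sets borel"
  have *: "(\<lambda>(s,\<omega>). Y (min (real n) s) \<omega>) \<in> lborel \<Otimes>\<^sub>M M \<rightarrow>\<^sub>M borel" for n
  proof -
    have "id \<in> M \<rightarrow>\<^sub>M F (real n)"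
      using measurable_ident by (rule measurable_from_subalg[OF subalgebra_F(1)])
    then have "(\<lambda>z. (fst z, snd z)) \<in> lborel \<Otimes>\<^sub>M M \<rightarrow>\<^sub>M lborel \<Otimes>\<^sub>M F (real n)"
      by (intro measurable_Pair) (auto simp: id_def intro: measurable_compose[OF measurable_snd])
    from measurable_compose[OF this Y_progressive] show ?thesis by (simp add: case_prod_unfold)
  qed
  have "(\<lambda>(s,\<omega>). Y s \<omega>) -` A \<inter> space (lborel \<Otimes>\<^sub>M M) =
    (\<Union>n. ((\<lambda>(s,\<omega>). Y (min (real n) s) \<omega>) -` A \<inter> space (lborel \<Otimes>\<^sub>M M)) \<inter> ({..real n} \<times> space M))"
    using real_arch_simple by (force simp: space_pair_measure min_absorb2)
  also have "\<dots> \<in> sets (lborel \<Otimes>\<^sub>M M)"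
    using measurable_sets[OF * A] by (intro sets.countable_UN) auto
  finally show "(\<lambda>(s,\<omega>). Y s \<omega>) -` A \<inter> space (lborel \<Otimes>\<^sub>M M) \<in> sets (lborel \<Otimes>\<^sub>M M)" .
qed auto

lemma Y_measurable [measurable (raw)]:
  assumes "g \<in> N \<rightarrow>\<^sub>M borel" "h \<in> N \<rightarrow>\<^sub>M M"
  shows "(\<lambda>z. Y (g z) (h z)) \<in> N \<rightarrow>\<^sub>M borel"
proof -
  have "g \<in> N \<rightarrow>\<^sub>M lborel" using assms(1) by simp
  from measurable_compose[OF measurable_Pair[OF this assms(2)] Y_joint] show ?thesis by simp
qed

lemma Y_adapted:
  assumes "0 \<le> t" shows "Y t \<in> F t \<rightarrow>\<^sub>M borel"
proof -
  have "(\<lambda>\<omega>. (t, \<omega>)) \<in> F t \<rightarrow>\<^sub>M lborel \<Otimes>\<^sub>M F t" by simp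
  from measurable_compose[OF this Y_progressive[OF assms]] show ?thesis by simp
qed

text \<open>Only times up to \<open>t\<close> matter, so \<open>Y s\<close> may be replaced by
  \<open>Y (min t s)\<close>, which is jointly measurable relative to \<open>F t\<close>. This makes
  the exponential weight in the Feynman-Kac argument admissible in the Markov property.\<close>

lemma additive_functional_adapted:
  fixes f :: "'a \<Rightarrow> real"
  assumes [measurable]: "f \<in> borel_measurable borel" and "0 \<le> t"
  shows "(\<lambda>\<omega>. LBINT s:{0..t}. f (Y s \<omega>)) \<in> borel_measurable (F t)"
proof -
  note [measurable] = Y_progressive[OF \<open>0 \<le> t\<close>]
  have "(\<lambda>\<omega>. LBINT s. indicator {0..t} s *\<^sub>R f (case (s,\<omega>) of (s,\<omega>) \<Rightarrow> Y (min t s) \<omega>)) \<in> borel_measurable (F t)"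
    by (rule lborel.borel_measurable_lebesgue_integral) measurable
  also have "(\<lambda>\<omega>. LBINT s. indicator {0..t} s *\<^sub>R f (case (s,\<omega>) of (s,\<omega>) \<Rightarrow> Y (min t s) \<omega>))
    = (\<lambda>\<omega>. LBINT s:{0..t}. f (Y s \<omega>))"
    unfolding set_lebesgue_integral_def
    by (intro ext Bochner_Integration.integral_cong) (auto split: split_indicator)
  finally show ?thesis .
qed

section \<open>The Markov property with weights depending on the past\<close>

lemma F_imp_P_measurable: "G \<in> F s \<rightarrow>\<^sub>M N \<Longrightarrow> G \<in> P x \<rightarrow>\<^sub>M N"
  using subalgebra_F(2) by (rule measurable_from_subalg)

text \<open>For the indicator of an event in \<open>F s\<close> this is the defining identity of the
  process; linearity and monotone convergence extend it to nonnegative \<open>G\<close>.\<close>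

lemma markov_property_set:
  fixes G :: "'w \<Rightarrow> ennreal"
  assumes G: "G \<in> borel_measurable (F s)" and A [measurable]: "A \<in> sets borel"
    and s: "0 \<le> s" and h: "0 \<le> h"
  shows "(\<integral>\<^sup>+\<omega>. G \<omega> * indicator A (Y (s + h) \<omega>) \<partial>P x)
       = (\<integral>\<^sup>+\<omega>. G \<omega> * emeasure (p h (Y s \<omega>)) A \<partial>P x)"
  using G
proof (induction rule: borel_measurable_induct)
  case (cong f g)
  have "(\<integral>\<^sup>+\<omega>. f \<omega> * k \<omega> \<partial>P x) = (\<integral>\<^sup>+\<omega>. g \<omega> * k \<omega> \<partial>P x)" for k
    using cong(3) by (intro nn_integral_cong) (simp add: space_P)
  then show ?case using cong(4) by simp
next
  case (set B)
  interpret prob_space "P x" by (rule prob_space_P)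
  interpret K: prob_space "p h y" for y using h by (rule prob_space_p)
  have [measurable]: "B \<in> sets M" using set natural_filtration_subset by (auto simp: sets_F)
  have [measurable]: "p h \<in> borel \<rightarrow>\<^sub>M subprob_algebra borel" using h by (rule transition_kernel_at)
  have B: "B \<subseteq> space M" by (rule sets.sets_into_space) measurable
  have X: "Y (s + h) = X (s + h)" "Y s = X s" using s h by (auto simp: Y_def max_def)
  have "(\<integral>\<^sup>+\<omega>. indicator B \<omega> * indicator A (Y (s + h) \<omega>) \<partial>P x)
      = (\<integral>\<^sup>+\<omega>. indicator (B \<inter> {\<omega>\<in>space M. Y (s + h) \<omega> \<in> A}) \<omega> \<partial>P x)"
    by (intro nn_integral_cong) (auto simp: space_P split: split_indicator)
  also have "\<dots> = emeasure (P x) (B \<inter> {\<omega>\<in>space M. Y (s + h) \<omega> \<in> A})"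
    by (intro nn_integral_indicator) measurable
  also have "\<dots> = ennreal (measure (P x) (B \<inter> {\<omega>\<in>space M. X (s + h) \<omega> \<in> A}))"
    by (simp add: emeasure_eq_measure X)
  also have "measure (P x) (B \<inter> {\<omega>\<in>space M. X (s + h) \<omega> \<in> A})
      = (\<integral>\<omega>. indicator B \<omega> * measure (p h (X s \<omega>)) A \<partial>(P x))"
    using markov s h A set by (auto simp: markov_process_def sets_F)
  also have "ennreal \<dots> = (\<integral>\<^sup>+\<omega>. ennreal (indicator B \<omega> * measure (p h (Y s \<omega>)) A) \<partial>P x)"
    unfolding X[symmetric]
  proof (rule nn_integral_eq_integral[symmetric])
    show "integrable (P x) (\<lambda>\<omega>. indicator B \<omega> * measure (p h (Y s \<omega>)) A)"
      by (rule integrable_const_bound[where B=1]) (auto split: split_indicator)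
  qed auto
  also have "\<dots> = (\<integral>\<^sup>+\<omega>. indicator B \<omega> * emeasure (p h (Y s \<omega>)) A \<partial>P x)"
    by (intro nn_integral_cong) (auto simp: K.emeasure_eq_measure split: split_indicator)
  finally show ?case .
next
  case (mult u c)
  note [measurable] = F_imp_P_measurable[OF mult(2)] transition_kernel_at[OF h]
  show ?case using mult by (simp add: mult.assoc nn_integral_cmult)
next
  case (add u v)
  note [measurable] = F_imp_P_measurable[OF add(1)] F_imp_P_measurable[OF add(3)] transition_kernel_at[OF h]
  show ?case using add by (simp add: distrib_right nn_integral_add)
next
  case (seq U)
  note [measurable] = F_imp_P_measurable[OF seq(1)] transition_kernel_at[OF h]
  have *: "(\<integral>\<^sup>+\<omega>. (\<Squnion>i. U i) \<omega> * g \<omega> \<partial>P x) = (\<Squnion>i. \<integral>\<^sup>+\<omega>. U i \<omega> * g \<omega> \<partial>P x)"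
    if [measurable]: "g \<in> borel_measurable (P x)" for g
  proof -
    have "(\<integral>\<^sup>+\<omega>. (\<Squnion>i. U i) \<omega> * g \<omega> \<partial>P x) = (\<integral>\<^sup>+\<omega>. (\<Squnion>i. U i \<omega> * g \<omega>) \<partial>P x)"
      by (simp add: SUP_mult_right_ennreal image_comp)
    also have "\<dots> = (\<Squnion>i. \<integral>\<^sup>+\<omega>. U i \<omega> * g \<omega> \<partial>P x)"
      using \<open>incseq U\<close>
      by (intro nn_integral_monotone_convergence_SUP) (auto simp: incseq_def le_fun_def intro!: mult_right_mono)
    finally show ?thesis .
  qed
  have m: "(\<lambda>\<omega>. indicator A (Y (s + h) \<omega>) :: ennreal) \<in> borel_measurable (P x)"
    "(\<lambda>\<omega>. emeasure (p h (Y s \<omega>)) A) \<in> borel_measurable (P x)"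
    by measurable
  show ?case unfolding *[OF m(1)] *[OF m(2)] using seq.IH by simp
qed

text \<open>Under the measure with density \<open>G\<close>, the previous lemma says that the law of
  \<open>Y (s + h)\<close> is the law of \<open>Y s\<close> pushed through the kernel
  \<open>p h\<close>. Integrating \<open>f\<close> against these equal measures gives the claim
  without an induction on \<open>f\<close>.\<close>

lemma markov_property_nn:
  fixes G :: "'w \<Rightarrow> ennreal" and f :: "'a \<Rightarrow> ennreal"
  assumes G: "G \<in> borel_measurable (F s)" and f: "f \<in> borel_measurable borel"
    and s: "0 \<le> s" and h: "0 \<le> h"
  shows "(\<integral>\<^sup>+\<omega>. G \<omega> * f (Y (s + h) \<omega>) \<partial>P x)
       = (\<integral>\<^sup>+\<omega>. G \<omega> * (\<integral>\<^sup>+y. f y \<partial>p h (Y s \<omega>)) \<partial>P x)"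
proof -
  note [measurable] = F_imp_P_measurable[OF G] transition_kernel_at[OF h] f
  let ?D = "density (P x) G"
  have "distr ?D borel (Y (s + h)) = distr ?D borel (Y s) \<bind> p h"
  proof (rule measure_eqI)
    show "sets (distr ?D borel (Y (s + h))) = sets (distr ?D borel (Y s) \<bind> p h)"
      by (subst sets_bind) (auto simp: sets_p h)
    fix A :: "'a set" assume "A \<in> sets (distr ?D borel (Y (s + h)))"
    then have [measurable]: "A \<in> sets borel" by simp
    have "emeasure (distr ?D borel (Y (s + h))) A = (\<integral>\<^sup>+\<omega>. indicator A (Y (s + h) \<omega>) \<partial>?D)"
      by (subst nn_integral_indicator[symmetric], simp, subst nn_integral_distr) auto
    also have "\<dots> = (\<integral>\<^sup>+\<omega>. emeasure (p h (Y s \<omega>)) A \<partial>?D)"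
      using markov_property_set[OF G _ s h, of A x] by (simp add: nn_integral_density)
    also have "\<dots> = emeasure (distr ?D borel (Y s) \<bind> p h) A"
      by (subst emeasure_bind[where N=borel]) (auto simp: nn_integral_distr transition_kernel_at h)
    finally show "emeasure (distr ?D borel (Y (s + h))) A = emeasure (distr ?D borel (Y s) \<bind> p h) A" .
  qed
  then have "(\<integral>\<^sup>+y. f y \<partial>distr ?D borel (Y (s + h))) = (\<integral>\<^sup>+y. f y \<partial>(distr ?D borel (Y s) \<bind> p h))"
    by simp
  also have "\<dots> = (\<integral>\<^sup>+y. \<integral>\<^sup>+z. f z \<partial>p h y \<partial>distr ?D borel (Y s))"
    by (subst nn_integral_bind[where B=borel]) (auto simp: transition_kernel_at h)
  finally show ?thesis by (simp add: nn_integral_distr nn_integral_density)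
qed

text \<open>Shifting by constants reduces signed bounded functions to the nonnegative case: apply it
  to \<open>G + C\<close> and \<open>f + B\<close>, expand the product, and remove the extra
  terms.\<close>

lemma markov_property:
  fixes G :: "'w \<Rightarrow> real" and f :: "'a \<Rightarrow> real"
  assumes G: "G \<in> borel_measurable (F s)" and Gb: "\<And>\<omega>. \<omega> \<in> space M \<Longrightarrow> \<bar>G \<omega>\<bar> \<le> C"
    and f: "f \<in> borel_measurable borel" and fb: "\<And>y. \<bar>f y\<bar> \<le> B"
    and s: "0 \<le> s" and h: "0 \<le> h"
  shows "(\<integral>\<omega>. G \<omega> * f (Y (s + h) \<omega>) \<partial>P x) = (\<integral>\<omega>. G \<omega> * q h f (Y s \<omega>) \<partial>P x)"
proof -
  interpret prob_space "P x" by (rule prob_space_P)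
  note [measurable] = F_imp_P_measurable[OF G] f
  have int: "integrable (P x) (\<lambda>\<omega>. g1 \<omega> * g2 \<omega>)"
    if "g1 \<in> borel_measurable (P x)" "g2 \<in> borel_measurable (P x)"
      "\<And>\<omega>. \<omega> \<in> space M \<Longrightarrow> \<bar>g1 \<omega>\<bar> \<le> c" "\<And>\<omega>. \<omega> \<in> space M \<Longrightarrow> \<bar>g2 \<omega>\<bar> \<le> d"
    for g1 g2 :: "'w \<Rightarrow> real" and c d
    by (rule integrable_const_bound[where B="c * d"])
       (use that in \<open>auto simp: space_P abs_mult intro!: mult_mono order_trans[OF abs_ge_zero that(3)]\<close>)
  have nonneg: "(\<integral>\<omega>. G \<omega> * f (Y (s + h) \<omega>) \<partial>P x) = (\<integral>\<omega>. G \<omega> * q h f (Y s \<omega>) \<partial>P x)"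
    if G: "G \<in> borel_measurable (F s)" and Gb: "\<And>\<omega>. \<omega> \<in> space M \<Longrightarrow> 0 \<le> G \<omega> \<and> G \<omega> \<le> C"
    and f[measurable]: "f \<in> borel_measurable borel" and fb: "\<And>y. 0 \<le> f y \<and> f y \<le> B" for G f C B
  proof -
    note [measurable] = F_imp_P_measurable[OF G]
    have fb': "\<bar>f y\<bar> \<le> B" for y using fb[of y] by simp
    have q: "(\<integral>\<^sup>+z. ennreal (f z) \<partial>p h y) = ennreal (q h f y)" for y
      using nn_integral_eq_integral[OF q_integrable[OF f fb', of h y]] fb h
      by (simp add: q_def trans_op_def max_def)
    have q0: "0 \<le> q h f y" for y
      using fb by (simp add: q_def trans_op_def integral_nonneg_AE)
    have "ennreal (\<integral>\<omega>. G \<omega> * f (Y (s + h) \<omega>) \<partial>P x) = (\<integral>\<^sup>+\<omega>. ennreal (G \<omega> * f (Y (s + h) \<omega>)) \<partial>P x)"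
      using Gb fb fb' by (intro nn_integral_eq_integral[symmetric] int[of _ _ C B])
        (auto simp: space_P intro!: AE_I2)
    also have "\<dots> = (\<integral>\<^sup>+\<omega>. ennreal (G \<omega>) * ennreal (f (Y (s + h) \<omega>)) \<partial>P x)"
      using Gb fb by (intro nn_integral_cong ennreal_mult) (auto simp: space_P)
    also have "\<dots> = (\<integral>\<^sup>+\<omega>. ennreal (G \<omega>) * ennreal (q h f (Y s \<omega>)) \<partial>P x)"
      using G by (subst markov_property_nn[OF _ _ s h, where G="\<lambda>\<omega>. ennreal (G \<omega>)" and f="\<lambda>y. ennreal (f y)"])
        (auto simp: q)
    also have "\<dots> = (\<integral>\<^sup>+\<omega>. ennreal (G \<omega> * q h f (Y s \<omega>)) \<partial>P x)"
      using Gb q0 by (intro nn_integral_cong ennreal_mult[symmetric]) (auto simp: space_P)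
    also have "\<dots> = ennreal (\<integral>\<omega>. G \<omega> * q h f (Y s \<omega>) \<partial>P x)"
      using Gb q0 abs_le_D1[OF q_bound[OF f fb']] q_bound[OF f fb']
      by (intro nn_integral_eq_integral int[of _ _ C B])
        (auto simp: space_P intro!: AE_I2)
    finally show ?thesis
      using Gb fb q0 by (subst (asm) ennreal_inj) (auto intro!: integral_nonneg_AE AE_I2 simp: space_P)
  qed
  have qm: "(\<lambda>\<omega>. q h f (Y s \<omega>)) \<in> borel_measurable (P x)" by measurable
  have fm: "(\<lambda>\<omega>. f (Y (s + h) \<omega>)) \<in> borel_measurable (P x)" by measurable
  have Gm: "G \<in> borel_measurable (P x)" by measurable
  have C: "0 \<le> C" 
    using Gb not_empty by (metis abs_ge_zero all_not_in_conv order_trans space_P)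
  have B: "0 \<le> B" using fb order_trans[OF abs_ge_zero] by blast
  have fB: "0 \<le> f y + B \<and> f y \<le> B" for y using fb[of y] by (simp add: abs_le_iff)
  have GC: "0 \<le> G \<omega> + C \<and> G \<omega> \<le> C" if "\<omega> \<in> space M" for \<omega>
    using Gb[OF that] by (simp add: abs_le_iff)
  \<comment> \<open>The case of weight 1. It matches the terms \<open>C * f\<close> and
    \<open>C * q h f\<close> that appear when the product in the next identity is expanded.\<close>
  have 0: "(\<integral>\<omega>. f (Y (s + h) \<omega>) + B \<partial>P x) = (\<integral>\<omega>. q h f (Y s \<omega>) + B \<partial>P x)"
    using nonneg[of "\<lambda>_. 1" 1 "\<lambda>y. f y + B" "2 * B"] fB f
    by (simp add: q_add_const[OF f fb])
  have 1: "(\<integral>\<omega>. (G \<omega> + C) * (f (Y (s + h) \<omega>) + B) \<partial>P x) = (\<integral>\<omega>. (G \<omega> + C) * (q h f (Y s \<omega>) + B) \<partial>P x)"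
    using nonneg[of "\<lambda>\<omega>. G \<omega> + C" "2 * C" "\<lambda>y. f y + B" "2 * B"] fB GC G f
    by (simp add: q_add_const[OF f fb])
  have i: "integrable (P x) (\<lambda>\<omega>. G \<omega> * f (Y (s + h) \<omega>))" "integrable (P x) (\<lambda>\<omega>. G \<omega> * q h f (Y s \<omega>))"
    "integrable (P x) (\<lambda>\<omega>. f (Y (s + h) \<omega>))" "integrable (P x) (\<lambda>\<omega>. q h f (Y s \<omega>))"
    "integrable (P x) G"
    using int[OF Gm fm Gb fb] int[OF Gm qm Gb q_bound[OF f fb]]
      int[OF _ fm, of "\<lambda>_. 1" 1 B] int[OF _ qm, of "\<lambda>_. 1" 1 B] int[OF Gm _ Gb, of "\<lambda>_. 1" 1]
      fb q_bound[OF f fb] by auto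
  show ?thesis using 0 1 i by (simp add: algebra_simps prob_space)
qed

lemma P_start: "AE \<omega> in P x. Y 0 \<omega> = x"
proof -
  interpret prob_space "P x" by (rule prob_space_P)
  have "measure (P x) {\<omega>\<in>space M. X 0 \<omega> = x} = 1"
    using markov by (simp add: markov_process_def)
  then have "prob {\<omega>\<in>space (P x). Y 0 \<omega> = x} = 1" by (simp add: Y_def space_P)
  \<comment> \<open>Measure 1 excludes the default value 0 of non-measurable sets, so the event is
    measurable although no separation axiom is available in the locale.\<close>
  moreover from this have "{\<omega>\<in>space (P x). Y 0 \<omega> = x} \<in> sets (P x)"
    using measure_notin_sets by fastforce
  ultimately have "AE \<omega> in P x. \<omega> \<in> {\<omega>\<in>space (P x). Y 0 \<omega> = x}"
    using AE_in_set_eq_1 by blast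
  then show ?thesis by (rule eventually_mono) simp
qed

lemma expectation_Y:
  assumes f [measurable]: "f \<in> borel_measurable borel" and fb: "\<And>y. \<bar>f y\<bar> \<le> B" and "0 \<le> t"
  shows "(\<integral>\<omega>. f (Y t \<omega>) \<partial>P x) = q t f x"
proof -
  interpret prob_space "P x" by (rule prob_space_P)
  have "(\<integral>\<omega>. f (Y t \<omega>) \<partial>P x) = (\<integral>\<omega>. q t f (Y 0 \<omega>) \<partial>P x)"
    using markov_property[of "\<lambda>_. 1" 0 1 f B t x] fb assms(3) f by simp
  also have "\<dots> = (\<integral>\<omega>. q t f x \<partial>P x)"
    by (rule integral_cong_AE) (auto intro: eventually_mono[OF P_start])
  finally show ?thesis by (simp add: prob_space)
qed

text \<open>The Chapman-Kolmogorov identity is not part of \<open>transition_function\<close>. It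
  holds at every \<open>x\<close> because a Markov process starts from each point: both sides are
  the expectation of \<open>f (Y (s + h))\<close> under \<open>P x\<close>.\<close>

lemma q_semigroup:
  assumes f [measurable]: "f \<in> borel_measurable borel" and fb: "\<And>y. \<bar>f y\<bar> \<le> B"
    and s: "0 \<le> s" and h: "0 \<le> h"
  shows "q s (q h f) x = q (s + h) f x"
proof -
  have "q s (q h f) x = (\<integral>\<omega>. q h f (Y s \<omega>) \<partial>P x)"
    using s q_bound[OF f fb] by (intro expectation_Y[symmetric, where B=B]) measurable
  also have "\<dots> = (\<integral>\<omega>. f (Y (s + h) \<omega>) \<partial>P x)"
    using markov_property[of "\<lambda>_. 1" s 1 f B h x] fb s h f by simp
  also have "\<dots> = q (s + h) f x" using s h by (intro expectation_Y[OF f fb]) auto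
  finally show ?thesis .
qed

subsection \<open>The Feynman-Kac formula\<close>

text \<open>The function \<open>\<phi> s = E^x[exp (A s) w(X_s)]\<close> has increments of order \<open>h\<^sup>2\<close>: in the expansion of
  \<open>exp (A (s + h)) = exp (A s) (1 + D + O(h\<^sup>2))\<close> the first-order terms
  \<open>E[exp (A s) (w(X_{s+h}) - w(X_s))]\<close> and \<open>E[exp (A s) D w(X_{s+h})]\<close> cancel up to \<open>O(h\<^sup>2)\<close> by the
  Markov property and \<open>V w = -g\<close>. No differentiation of \<open>A\<close> along paths is needed.\<close>

lemma feynman_kac:
  assumes [measurable]: "w \<in> borel_measurable borel" "g \<in> borel_measurable borel"
    and w: "\<And>y. \<epsilon> \<le> w y" "\<And>y. w y \<le> W" and "0 < \<epsilon>"
    and g: "\<And>y. \<bar>g y\<bar> \<le> L"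
    and gen: "\<And>h y. 0 \<le> h \<Longrightarrow> q h w y - w y = (LBINT r:{0..h}. q r g y)"
    and t: "0 \<le> t"
  shows "(\<integral>\<omega>. exp (LBINT s:{0..t}. - g (Y s \<omega>) / w (Y s \<omega>)) * w (Y t \<omega>) \<partial>P x) = w x"
proof -
  interpret prob_space "P x" by (rule prob_space_P)
  define V where "V y = - g y / w y" for y
  define K where "K = L / \<epsilon>"
  have [measurable]: "V \<in> borel_measurable borel" unfolding V_def by measurable
  have w0: "0 < w y" for y using w(1)[of y] \<open>0 < \<epsilon>\<close> by linarith
  have wb: "\<bar>w y\<bar> \<le> W" for y using w0[of y] w(2)[of y] by simp
  have W: "0 \<le> W" using wb order_trans[OF abs_ge_zero] by blast
  have L: "0 \<le> L" using g order_trans[OF abs_ge_zero] by blast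
  have K: "0 \<le> K" using L \<open>0 < \<epsilon>\<close> by (simp add: K_def)
  have Vb: "\<bar>V y\<bar> \<le> K" for y
    using g[of y] w(1)[of y] w0[of y] \<open>0 < \<epsilon>\<close> L unfolding V_def K_def by (auto intro!: frac_le)
  have Vw: "V y * w y = - g y" for y using w0[of y] by (simp add: V_def)
  define A where "A u \<omega> = (LBINT s:{0..u}. V (Y s \<omega>))" for u \<omega>
  have Ab: "\<bar>A u \<omega>\<bar> \<le> K * u" if "0 \<le> u" "\<omega> \<in> space M" for u \<omega>
    unfolding A_def
    using set_integral_bound(2)[of "\<lambda>s. V (Y s \<omega>)" 0 u K] Vb that by simp
  define \<phi> where "\<phi> s = (\<integral>\<omega>. exp (A s \<omega>) * w (Y s \<omega>) \<partial>P x)" for s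
  \<comment> \<open>A bound for \<open>exp (A s \<omega>)\<close> that is uniform over all
    \<open>s \<le> t\<close>.\<close>
  define E where "E = exp (K * t)"
  have E: "0 \<le> E" by (simp add: E_def)
  \<comment> \<open>Chosen so that \<open>h \<le> \<delta>\<close> gives
    \<open>K * h \<le> 1/2\<close>, as the exponential estimate requires; \<open>K + 1\<close> keeps
    the denominator positive when \<open>K = 0\<close>.\<close>
  define \<delta> where "\<delta> = 1 / (2 * (K + 1))"
  have "\<phi> t = \<phi> 0"
  proof (rule constant_if_quadratic_increments[OF t])
    show "0 < \<delta>" using K by (simp add: \<delta>_def)
    fix s h assume s: "0 \<le> s" and h: "0 \<le> h" and "h \<le> \<delta>" and sh: "s + h \<le> t"
    have Kh: "K * h \<le> 1/2"
    proof -
      have "K * h \<le> (K + 1) * \<delta>" using K h \<open>h \<le> \<delta>\<close> by (intro mult_mono) auto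
      moreover have "(K + 1) * \<delta> = 1/2" using K by (simp add: \<delta>_def divide_simps)
      ultimately show ?thesis by simp
    qed
    define G where "G \<omega> = exp (A s \<omega>)" for \<omega>
    define D where "D \<omega> = (LBINT r:{0..h}. V (Y (s + r) \<omega>))" for \<omega>
    have GF: "G \<in> borel_measurable (F s)"
      unfolding G_def A_def using additive_functional_adapted[OF _ s, of V] by simp
    have [measurable]: "G \<in> borel_measurable M"
      using measurable_from_subalg[OF subalgebra_F(1) GF] .
    have [measurable]: "D \<in> borel_measurable M"
      unfolding D_def set_lebesgue_integral_def
      by (rule lborel.borel_measurable_lebesgue_integral) measurable
    have Gb: "\<bar>G \<omega>\<bar> \<le> E" if "\<omega> \<in> space M" for \<omega>
    proof -
      have "A s \<omega> \<le> K * s" using Ab[OF s that] by simp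
      also have "\<dots> \<le> K * t" using K sh h by (intro mult_left_mono) auto
      finally show ?thesis by (simp add: G_def E_def)
    qed
    have Db: "\<bar>D \<omega>\<bar> \<le> K * h" if "\<omega> \<in> space M" for \<omega>
      unfolding D_def
      using set_integral_bound(2)[of "\<lambda>r. V (Y (s + r) \<omega>)" 0 h K] Vb that h by simp
    have AD: "A (s + h) \<omega> = A s \<omega> + D \<omega>" if "\<omega> \<in> space M" for \<omega>
      unfolding A_def D_def
      using set_integral_adjacent[of "\<lambda>s. V (Y s \<omega>)" 0 "s + h" K s] Vb that s h
        set_integral_shift[of 0 h "\<lambda>s. V (Y s \<omega>)" s]
      by (simp add: add.commute)
    have wd: "\<bar>q r w y - w y\<bar> \<le> L * r" if "0 \<le> r" for r y
      unfolding gen[OF that]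
      using set_integral_bound(2)[of "\<lambda>r. q r g y" 0 r L] q_bound[of g L] g that by simp
    let ?T1 = "\<integral>\<omega>. G \<omega> * (exp (D \<omega>) - 1 - D \<omega>) * w (Y (s + h) \<omega>) \<partial>P x"
    let ?T2 = "\<integral>\<omega>. G \<omega> * w (Y (s + h) \<omega>) - G \<omega> * w (Y s \<omega>) \<partial>P x"
    let ?T3 = "\<integral>\<omega>. G \<omega> * D \<omega> * w (Y (s + h) \<omega>) \<partial>P x"
    have expD: "\<bar>exp (D \<omega>) - 1 - D \<omega>\<bar> \<le> 2 * (K * h)\<^sup>2" if "\<omega> \<in> space M" for \<omega>
    proof -
      have "\<bar>exp (D \<omega>) - 1 - D \<omega>\<bar> \<le> 2 * (D \<omega>)\<^sup>2"
        using Db[OF that] Kh by (intro abs_exp_minus_one_minus_le) simp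
      also have "(D \<omega>)\<^sup>2 \<le> (K * h)\<^sup>2" using Db[OF that] by (simp add: abs_le_square_iff[symmetric] K h)
      finally show ?thesis by simp
    qed
    have b1: "\<bar>G \<omega> * (exp (D \<omega>) - 1 - D \<omega>) * w (Y (s + h) \<omega>)\<bar> \<le> E * (2 * (K * h)\<^sup>2) * W"
      if "\<omega> \<in> space (P x)" for \<omega>
      unfolding abs_mult using Gb expD wb that E by (intro mult_mono) (auto simp: space_P)
    have b2: "\<bar>G \<omega> * w (Y r \<omega>)\<bar> \<le> E * W" if "\<omega> \<in> space (P x)" for r \<omega>
      unfolding abs_mult using Gb wb that E by (intro mult_mono) (auto simp: space_P)
    have b3: "\<bar>G \<omega> * D \<omega> * w (Y (s + h) \<omega>)\<bar> \<le> E * (K * h) * W" if "\<omega> \<in> space (P x)" for \<omega>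
      unfolding abs_mult using Gb Db wb that E K h by (intro mult_mono) (auto simp: space_P)
    have i1: "integrable (P x) (\<lambda>\<omega>. G \<omega> * (exp (D \<omega>) - 1 - D \<omega>) * w (Y (s + h) \<omega>))"
      by (rule bounded_expectation(1)[OF _ b1]) measurable
    have i2: "integrable (P x) (\<lambda>\<omega>. G \<omega> * w (Y r \<omega>))" for r
      by (rule bounded_expectation(1)[OF _ b2]) measurable
    have i3: "integrable (P x) (\<lambda>\<omega>. G \<omega> * D \<omega> * w (Y (s + h) \<omega>))"
      by (rule bounded_expectation(1)[OF _ b3]) measurable
    have split: "\<phi> (s + h) - \<phi> s = ?T1 + (?T2 + ?T3)"
    proof -
      have "\<phi> (s + h) = (\<integral>\<omega>. G \<omega> * (exp (D \<omega>) - 1 - D \<omega>) * w (Y (s + h) \<omega>)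
          + (G \<omega> * w (Y (s + h) \<omega>) + G \<omega> * D \<omega> * w (Y (s + h) \<omega>)) \<partial>P x)"
        unfolding \<phi>_def
      proof (rule Bochner_Integration.integral_cong[OF refl])
        fix \<omega> assume "\<omega> \<in> space (P x)"
        then have "exp (A (s + h) \<omega>) = G \<omega> * exp (D \<omega>)" by (simp add: space_P AD exp_add G_def)
        then show "exp (A (s + h) \<omega>) * w (Y (s + h) \<omega>) = G \<omega> * (exp (D \<omega>) - 1 - D \<omega>) * w (Y (s + h) \<omega>)
          + (G \<omega> * w (Y (s + h) \<omega>) + G \<omega> * D \<omega> * w (Y (s + h) \<omega>))"
          by (simp only:) (simp add: algebra_simps)
      qed
      then show ?thesis using i1 i2 i3 by (simp add: \<phi>_def G_def)
    qed
    have T1: "\<bar>?T1\<bar> \<le> E * (2 * (K * h)\<^sup>2) * W"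
      by (rule bounded_expectation(2)[OF _ b1]) measurable
    have GVF: "(\<lambda>\<omega>. G \<omega> * V (Y (s + r) \<omega>)) \<in> borel_measurable (F (s + r))" if "0 \<le> r" for r
    proof -
      have [measurable]: "G \<in> borel_measurable (F (s + r))"
        using measurable_F_mono[OF _ GF] that by simp
      have [measurable]: "Y (s + r) \<in> F (s + r) \<rightarrow>\<^sub>M borel" using s that by (intro Y_adapted) simp
      show ?thesis by measurable
    qed
    have GVb: "\<bar>G \<omega> * V (Y r \<omega>)\<bar> \<le> E * K" if "\<omega> \<in> space M" for r \<omega>
      unfolding abs_mult using Gb Vb that E by (intro mult_mono) auto
    \<comment> \<open>Conditioning at time \<open>s\<close> replaces \<open>w (Y (s + h))\<close> by
      \<open>q h w (Y s)\<close>, and \<open>gen\<close> writes the difference as a time integral.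
      The Markov property read backwards then turns \<open>q r g (Y s)\<close> into
      \<open>g (Y (s + r))\<close>.\<close>
    have T2: "?T2 = (LBINT r:{0..h}. (\<integral>\<omega>. G \<omega> * g (Y (s + r) \<omega>) \<partial>P x))"
    proof -
      have "(\<integral>\<omega>. G \<omega> * w (Y (s + h) \<omega>) \<partial>P x) = (\<integral>\<omega>. G \<omega> * q h w (Y s \<omega>) \<partial>P x)"
        by (rule markov_property[OF GF Gb _ wb s h]) auto
      moreover have "integrable (P x) (\<lambda>\<omega>. G \<omega> * q h w (Y s \<omega>))"
      proof (rule bounded_expectation(1))
        show "\<bar>G \<omega> * q h w (Y s \<omega>)\<bar> \<le> E * W" if "\<omega> \<in> space (P x)" for \<omega>
          unfolding abs_mult using Gb q_bound[of w W] wb that E by (intro mult_mono) (auto simp: space_P)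
      qed measurable
      ultimately have "?T2 = (\<integral>\<omega>. G \<omega> * q h w (Y s \<omega>) - G \<omega> * w (Y s \<omega>) \<partial>P x)"
        using i2 by simp
      also have "\<dots> = (\<integral>\<omega>. (LBINT r:{0..h}. G \<omega> * q r g (Y s \<omega>)) \<partial>P x)"
        using gen[OF h] by (simp add: right_diff_distrib[symmetric])
      also have "\<dots> = (LBINT r:{0..h}. (\<integral>\<omega>. G \<omega> * q r g (Y s \<omega>) \<partial>P x))"
      proof (rule set_integral_Fubini)
        show "\<bar>G \<omega> * q r g (Y s \<omega>)\<bar> \<le> E * L" if "\<omega> \<in> space (P x)" for r \<omega>
          unfolding abs_mult using Gb q_bound[of g L] g that E by (intro mult_mono) (auto simp: space_P)
      qed measurable
      also have "\<dots> = (LBINT r:{0..h}. (\<integral>\<omega>. G \<omega> * g (Y (s + r) \<omega>) \<partial>P x))"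
      proof (rule set_lebesgue_integral_cong)
        show "\<forall>r. r \<in> {0..h} \<longrightarrow> (\<integral>\<omega>. G \<omega> * q r g (Y s \<omega>) \<partial>P x) = (\<integral>\<omega>. G \<omega> * g (Y (s + r) \<omega>) \<partial>P x)"
          using markov_property[where f=g, OF GF Gb _ g s, symmetric] by auto
      qed auto
      finally show ?thesis .
    qed
    \<comment> \<open>Here the conditioning is at the intermediate time \<open>s + r\<close>, where
      the weight \<open>G \<omega> * V (Y (s + r) \<omega>)\<close> is already known; the remaining
      time is \<open>h - r\<close>.\<close>
    have T3: "?T3 = (LBINT r:{0..h}. (\<integral>\<omega>. G \<omega> * V (Y (s + r) \<omega>) * q (h - r) w (Y (s + r) \<omega>) \<partial>P x))"
    proof -
      have "?T3 = (\<integral>\<omega>. (LBINT r:{0..h}. G \<omega> * V (Y (s + r) \<omega>) * w (Y (s + h) \<omega>)) \<partial>P x)"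
        by (simp add: D_def)
      also have "\<dots> = (LBINT r:{0..h}. (\<integral>\<omega>. G \<omega> * V (Y (s + r) \<omega>) * w (Y (s + h) \<omega>) \<partial>P x))"
      proof (rule set_integral_Fubini)
        show "\<bar>G \<omega> * V (Y (s + r) \<omega>) * w (Y (s + h) \<omega>)\<bar> \<le> E * K * W" if "\<omega> \<in> space (P x)" for r \<omega>
          unfolding abs_mult using Gb Vb wb that E K by (intro mult_mono) (auto simp: space_P)
      qed measurable
      also have "\<dots> = (LBINT r:{0..h}. (\<integral>\<omega>. G \<omega> * V (Y (s + r) \<omega>) * q (h - r) w (Y (s + r) \<omega>) \<partial>P x))"
      proof (rule set_lebesgue_integral_cong)
        show "\<forall>r. r \<in> {0..h} \<longrightarrow> (\<integral>\<omega>. G \<omega> * V (Y (s + r) \<omega>) * w (Y (s + h) \<omega>) \<partial>P x)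
          = (\<integral>\<omega>. G \<omega> * V (Y (s + r) \<omega>) * q (h - r) w (Y (s + r) \<omega>) \<partial>P x)"
        proof (intro allI impI)
          fix r assume r: "r \<in> {0..h}"
          then show "(\<integral>\<omega>. G \<omega> * V (Y (s + r) \<omega>) * w (Y (s + h) \<omega>) \<partial>P x)
            = (\<integral>\<omega>. G \<omega> * V (Y (s + r) \<omega>) * q (h - r) w (Y (s + r) \<omega>) \<partial>P x)"
            using markov_property[where f=w and h="h - r", OF GVF[of r] GVb _ wb] s by auto
        qed
      qed auto
      finally show ?thesis .
    qed
    let ?J = "\<lambda>r. \<integral>\<omega>. G \<omega> * V (Y (s + r) \<omega>) * (q (h - r) w (Y (s + r) \<omega>) - w (Y (s + r) \<omega>)) \<partial>P x"
    have "?T2 + ?T3 = (LBINT r:{0..h}. (\<integral>\<omega>. G \<omega> * g (Y (s + r) \<omega>) \<partial>P x)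
        + (\<integral>\<omega>. G \<omega> * V (Y (s + r) \<omega>) * q (h - r) w (Y (s + r) \<omega>) \<partial>P x))"
      unfolding T2 T3
    proof (rule set_integral_add(2)[symmetric])
      show "set_integrable lborel {0..h} (\<lambda>r. \<integral>\<omega>. G \<omega> * g (Y (s + r) \<omega>) \<partial>P x)"
      proof (rule set_integral_bound(1)[OF _ _ h])
        show "\<bar>\<integral>\<omega>. G \<omega> * g (Y (s + r) \<omega>) \<partial>P x\<bar> \<le> E * L" for r
        proof (rule bounded_expectation(2))
          show "\<bar>G \<omega> * g (Y (s + r) \<omega>)\<bar> \<le> E * L" if "\<omega> \<in> space (P x)" for \<omega>
            unfolding abs_mult using Gb g that E by (intro mult_mono) (auto simp: space_P)
        qed measurable
      qed measurable
      show "set_integrable lborel {0..h}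
        (\<lambda>r. \<integral>\<omega>. G \<omega> * V (Y (s + r) \<omega>) * q (h - r) w (Y (s + r) \<omega>) \<partial>P x)"
      proof (rule set_integral_bound(1)[OF _ _ h])
        show "\<bar>\<integral>\<omega>. G \<omega> * V (Y (s + r) \<omega>) * q (h - r) w (Y (s + r) \<omega>) \<partial>P x\<bar> \<le> E * K * W" for r
        proof (rule bounded_expectation(2))
          show "\<bar>G \<omega> * V (Y (s + r) \<omega>) * q (h - r) w (Y (s + r) \<omega>)\<bar> \<le> E * K * W"
            if "\<omega> \<in> space (P x)" for \<omega>
            unfolding abs_mult using Gb Vb q_bound[of w W] wb that E K
            by (intro mult_mono) (auto simp: space_P)
        qed measurable
      qed measurable
    qed
    \<comment> \<open>Since \<open>V y * w y = - g y\<close>, the term with \<open>g\<close> is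
      exactly what subtracts \<open>w\<close> from \<open>q (h - r) w\<close>.\<close>
    also have "\<dots> = (LBINT r:{0..h}. ?J r)"
    proof (rule set_lebesgue_integral_cong)
      have "(\<integral>\<omega>. G \<omega> * g (Y (s + r) \<omega>) \<partial>P x)
        + (\<integral>\<omega>. G \<omega> * V (Y (s + r) \<omega>) * q (h - r) w (Y (s + r) \<omega>) \<partial>P x) = ?J r" for r
      proof -
        have "integrable (P x) (\<lambda>\<omega>. G \<omega> * g (Y (s + r) \<omega>))"
        proof (rule bounded_expectation(1))
          show "\<bar>G \<omega> * g (Y (s + r) \<omega>)\<bar> \<le> E * L" if "\<omega> \<in> space (P x)" for \<omega>
            unfolding abs_mult using Gb g that E by (intro mult_mono) (auto simp: space_P)
        qed measurable
        moreover have "integrable (P x) (\<lambda>\<omega>. G \<omega> * V (Y (s + r) \<omega>) * q (h - r) w (Y (s + r) \<omega>))"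
        proof (rule bounded_expectation(1))
          show "\<bar>G \<omega> * V (Y (s + r) \<omega>) * q (h - r) w (Y (s + r) \<omega>)\<bar> \<le> E * K * W"
            if "\<omega> \<in> space (P x)" for \<omega>
            unfolding abs_mult using Gb Vb q_bound[of w W] wb that E K
            by (intro mult_mono) (auto simp: space_P)
        qed measurable
        ultimately show ?thesis
          by (subst Bochner_Integration.integral_add[symmetric])
             (auto intro!: Bochner_Integration.integral_cong simp: right_diff_distrib mult.assoc Vw)
      qed
      then show "\<forall>r. r \<in> {0..h} \<longrightarrow> (\<integral>\<omega>. G \<omega> * g (Y (s + r) \<omega>) \<partial>P x)
        + (\<integral>\<omega>. G \<omega> * V (Y (s + r) \<omega>) * q (h - r) w (Y (s + r) \<omega>) \<partial>P x) = ?J r"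
        by blast
    qed auto
    \<comment> \<open>One factor \<open>h\<close> comes from the bound \<open>wd\<close> on
      \<open>q (h - r) w - w\<close>, the other from the length of the interval.\<close>
    also have "\<bar>\<dots>\<bar> \<le> E * K * (L * h) * (h - 0)"
    proof (rule set_integral_bound(2)[OF _ _ h])
      fix r assume r: "r \<in> {0..h}"
      show "\<bar>?J r\<bar> \<le> E * K * (L * h)"
      proof (rule bounded_expectation(2))
        fix \<omega> assume \<omega>: "\<omega> \<in> space (P x)"
        have "\<bar>q (h - r) w (Y (s + r) \<omega>) - w (Y (s + r) \<omega>)\<bar> \<le> L * (h - r)"
          using r by (intro wd) auto
        also have "\<dots> \<le> L * h" using r L by (intro mult_left_mono) auto
        finally show "\<bar>G \<omega> * V (Y (s + r) \<omega>) * (q (h - r) w (Y (s + r) \<omega>) - w (Y (s + r) \<omega>))\<bar>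
          \<le> E * K * (L * h)"
          unfolding abs_mult using Gb Vb \<omega> E K L h by (intro mult_mono) (auto simp: space_P)
      qed measurable
    qed measurable
    finally have T23: "\<bar>?T2 + ?T3\<bar> \<le> E * K * L * h\<^sup>2" by (simp add: power2_eq_square)
    have "\<bar>\<phi> (s + h) - \<phi> s\<bar> \<le> E * (2 * (K * h)\<^sup>2) * W + E * K * L * h\<^sup>2"
      unfolding split using abs_triangle_ineq[of ?T1 "?T2 + ?T3"] T1 T23 by linarith
    also have "\<dots> = (E * 2 * K\<^sup>2 * W + E * K * L) * h\<^sup>2"
      by (simp add: algebra_simps power2_eq_square)
    finally show "\<bar>\<phi> (s + h) - \<phi> s\<bar> \<le> (E * 2 * K\<^sup>2 * W + E * K * L) * h\<^sup>2" .
  qed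
  also have "\<phi> 0 = w x"
  proof -
    have "A 0 \<omega> = 0" if "\<omega> \<in> space M" for \<omega> using Ab[OF _ that, of 0] by simp
    then have "\<phi> 0 = (\<integral>\<omega>. w (Y 0 \<omega>) \<partial>P x)"
      unfolding \<phi>_def by (intro Bochner_Integration.integral_cong) (auto simp: space_P)
    also have "\<dots> = (\<integral>\<omega>. w x \<partial>P x)"
      by (rule integral_cong_AE) (auto intro: eventually_mono[OF P_start])
    finally show ?thesis by (simp add: prob_space)
  qed
  finally show ?thesis by (simp add: \<phi>_def A_def V_def)
qed

text \<open>Applying \<open>q h\<close> shifts the averaging window from \<open>{0..t}\<close> to
  \<open>{h..t + h}\<close>. The overlap cancels, and what remains are the two end pieces of length
  \<open>h\<close>, which combine into the integral of \<open>q r g\<close>. The identity is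
  pointwise, with no exceptional null set.\<close>

lemma D1_generator:
  assumes u [measurable]: "u \<in> borel_measurable borel" and ub: "\<And>y. \<bar>u y\<bar> \<le> C" and t: "0 < t"
  defines "v \<equiv> \<lambda>x. (1 / t) * (LBINT s:{0..t}. q s u x)"
    and "g \<equiv> \<lambda>x. (1 / t) * (q t u x - u x)"
  shows "v \<in> borel_measurable borel" "\<bar>v y\<bar> \<le> C"
    and "g \<in> borel_measurable borel" "\<bar>g y\<bar> \<le> (1 / t) * (2 * C)"
    and "0 \<le> h \<Longrightarrow> q h v x - v x = (LBINT r:{0..h}. q r g x)"
proof -
  have qm [measurable]: "(\<lambda>s. q s u x) \<in> borel_measurable borel" for x by measurable
  have qb: "\<bar>q s u y\<bar> \<le> C" for s y by (rule q_bound[OF u ub])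
  show vm: "v \<in> borel_measurable borel"
    unfolding v_def set_lebesgue_integral_def
    by (intro borel_measurable_times lborel.borel_measurable_lebesgue_integral) measurable
  show vb: "\<bar>v y\<bar> \<le> C" for y
    using set_integral_bound(2)[of "\<lambda>s. q s u y" 0 t C] qb t
    by (simp add: v_def abs_mult divide_simps mult.commute)
  show gm: "g \<in> borel_measurable borel" unfolding g_def by measurable
  show "\<bar>g y\<bar> \<le> (1 / t) * (2 * C)"
    unfolding g_def abs_mult using t qb[of t y] ub[of y]
    by (intro mult_mono) (auto simp: abs_le_iff)
  show "q h v x - v x = (LBINT r:{0..h}. q r g x)" if h: "0 \<le> h"
  proof -
    interpret prob_space "p h x" using h by (rule prob_space_p)
    note [measurable_cong] = sets_p[OF h]
    have "q h v x = (1 / t) * (\<integral>y. (LBINT s:{0..t}. q s u y) \<partial>p h x)"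
      using h by (simp add: q_def trans_op_def v_def max_def)
    also have "(\<integral>y. (LBINT s:{0..t}. q s u y) \<partial>p h x) = (LBINT s:{0..t}. (\<integral>y. q s u y \<partial>p h x))"
    proof (rule set_integral_Fubini)
      show "\<bar>q s u y\<bar> \<le> C" for s y by (rule qb)
    qed measurable
    also have "\<dots> = (LBINT s:{0..t}. q (s + h) u x)"
    proof (rule set_lebesgue_integral_cong)
      show "\<forall>s. s \<in> {0..t} \<longrightarrow> (\<integral>y. q s u y \<partial>p h x) = q (s + h) u x"
        using q_semigroup[OF u ub h, of _ x] h
        by (auto simp: q_def[of h] trans_op_def[of p h] max_def add.commute)
    qed simp
    also have "\<dots> = (LBINT s:{h..t + h}. q s u x)"
      using set_integral_shift[of 0 t "\<lambda>s. q s u x" h] by simp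
    finally have "q h v x - v x = (1 / t) * ((LBINT s:{h..t + h}. q s u x) - (LBINT s:{0..t}. q s u x))"
      by (simp add: v_def right_diff_distrib)
    \<comment> \<open>Splitting \<open>{0..t + h}\<close> once at \<open>h\<close> and once at
      \<open>t\<close> gives this without comparing \<open>h\<close> and \<open>t\<close>.\<close>
    also have "(LBINT s:{h..t + h}. q s u x) - (LBINT s:{0..t}. q s u x)
        = (LBINT s:{t..t + h}. q s u x) - (LBINT s:{0..h}. q s u x)"
      using set_integral_adjacent[OF qm qb, of 0 h "t + h" x]
        set_integral_adjacent[OF qm qb, of 0 t "t + h" x] h t by simp
    also have "(LBINT s:{t..t + h}. q s u x) = (LBINT r:{0..h}. q (r + t) u x)"
      using set_integral_shift[of 0 h "\<lambda>s. q s u x" t] by (simp add: add.commute)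
    also have "\<dots> - (LBINT s:{0..h}. q s u x) = (LBINT r:{0..h}. q (r + t) u x - q r u x)"
      using qb h by (intro set_integral_diff(2)[symmetric] set_integral_bound(1)[where C=C]) auto
    also have "(1 / t) * \<dots> = (LBINT r:{0..h}. (1 / t) * (q (r + t) u x - q r u x))"
      by (rule set_integral_mult_right[symmetric])
    also have "\<dots> = (LBINT r:{0..h}. q r g x)"
    proof (rule set_lebesgue_integral_cong)
      have "(1 / t) * (q (r + t) u x - q r u x) = q r g x" if "0 \<le> r" for r
      proof -
        have qtm: "q t u \<in> borel_measurable borel" by measurable
        have "q r g x = (1 / t) * (q r (q t u) x - q r u x)"
          using q_integrable[OF qtm qb, of r x] q_integrable[OF u ub, of r x]
          by (simp add: q_def[of r] trans_op_def[of p "max 0 r"] g_def)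
        then show ?thesis using q_semigroup[OF u ub that, of t x] t by simp
      qed
      then show "\<forall>r. r \<in> {0..h} \<longrightarrow> (1 / t) * (q (r + t) u x - q r u x) = q r g x" by simp
    qed simp
    finally show ?thesis .
  qed
qed

section \<open>Occupation measures and the exponential Chebyshev inequality\<close>

lemma integral_occupation_measure:
  fixes f :: "'a \<Rightarrow> real"
  assumes [measurable]: "f \<in> borel_measurable borel" and t: "0 < t" and \<omega> [measurable]: "\<omega> \<in> space M"
    and "prob_space (occupation_measure X t \<omega>)"
  shows "(\<integral>y. f y \<partial>occupation_measure X t \<omega>) = (1 / t) * (LBINT s:{0..t}. f (Y s \<omega>))"
proof -
  let ?U = "uniform_measure lborel {0..t}"
  \<comment> \<open>Being a probability measure excludes the junk value of \<open>distr\<close>, so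
    this particular path is measurable on the whole line and the change of variables
    applies.\<close>
  have "(\<lambda>s. X s \<omega>) \<in> ?U \<rightarrow>\<^sub>M borel"
    using assms(4) unfolding occupation_measure_def by (rule prob_space_distr_imp_measurable) auto
  then have [measurable]: "(\<lambda>s. X s \<omega>) \<in> borel \<rightarrow>\<^sub>M borel" 
    by (simp cong: measurable_cong_sets)
  have "(\<integral>y. f y \<partial>occupation_measure X t \<omega>) = (\<integral>s. f (X s \<omega>) \<partial>?U)"
    unfolding occupation_measure_def by (subst integral_distr) auto
  also have "?U = density lborel (\<lambda>s. ennreal (indicator {0..t} s / t))"
    unfolding uniform_measure_def using t
    by (intro density_cong) (auto simp: divide_ennreal ennreal_1[symmetric] simp del: ennreal_1 split: split_indicator)
  also have "(\<integral>s. f (X s \<omega>) \<partial>\<dots>) = (\<integral>s. (indicator {0..t} s / t) *\<^sub>R f (X s \<omega>) \<partial>lborel)"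
    using t by (intro integral_density) (auto split: split_indicator)
  also have "\<dots> = (\<integral>s. (1 / t) * (indicator {0..t} s *\<^sub>R f (Y s \<omega>)) \<partial>lborel)"
    by (intro Bochner_Integration.integral_cong) (auto simp: Y_def max_def split: split_indicator)
  finally show ?thesis by (simp add: set_lebesgue_integral_def)
qed

text \<open>On the event, the time integral of \<open>- g / w\<close> exceeds \<open>a * t\<close>
  and \<open>w\<close> is at least \<open>\<epsilon>\<close>, so the indicator is at most
  \<open>exp (- a * t) / \<epsilon>\<close> times the Feynman-Kac integrand, whose expectation is
  \<open>w x\<close>.\<close>

lemma exponential_chebyshev:
  assumes [measurable]: "w \<in> borel_measurable borel" "g \<in> borel_measurable borel"
    and w: "\<And>y. \<epsilon> \<le> w y" "\<And>y. w y \<le> W" and \<epsilon>: "0 < \<epsilon>"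
    and g: "\<And>y. \<bar>g y\<bar> \<le> L"
    and gen: "\<And>h y. 0 \<le> h \<Longrightarrow> q h w y - w y = (LBINT r:{0..h}. q r g y)"
    and t: "0 < t"
    and N: "\<And>\<nu>. \<nu> \<in> N \<Longrightarrow> prob_space \<nu> \<and> a < (\<integral>y. - g y / w y \<partial>\<nu>)"
  shows "measure (P x) {\<omega>\<in>space M. occupation_measure X t \<omega> \<in> N} \<le> exp (- a * t) * (w x / \<epsilon>)"
    (is "measure _ ?S \<le> _")
proof (cases "?S \<in> sets (P x)")
  \<comment> \<open>Measurability of the event is not established; if it fails,
    \<open>measure\<close> returns 0 and the bound is trivial.\<close>
  case False
  then show ?thesis using w(1)[of x] \<epsilon> by (simp add: measure_notin_sets)
next
  case S [measurable]: True
  interpret prob_space "P x" by (rule prob_space_P)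
  have w0: "0 < w y" for y using w(1)[of y] \<epsilon> by linarith
  let ?A = "\<lambda>\<omega>. LBINT s:{0..t}. - g (Y s \<omega>) / w (Y s \<omega>)"
  have [measurable]: "?A \<in> borel_measurable (P x)"
    unfolding set_lebesgue_integral_def
    by (rule lborel.borel_measurable_lebesgue_integral) measurable
  have L: "0 \<le> L" using g order_trans[OF abs_ge_zero] by blast
  have Vb: "\<bar>- g y / w y\<bar> \<le> L / \<epsilon>" for y
    using g[of y] w(1)[of y] w0[of y] \<epsilon> L by (auto intro!: frac_le)
  have Ab: "\<bar>?A \<omega>\<bar> \<le> L / \<epsilon> * t" if "\<omega> \<in> space M" for \<omega>
    using set_integral_bound(2)[of "\<lambda>s. - g (Y s \<omega>) / w (Y s \<omega>)" 0 t "L / \<epsilon>"] Vb that t by simp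
  have int: "integrable (P x) (\<lambda>\<omega>. exp (?A \<omega>) * w (Y t \<omega>))"
  proof (rule bounded_expectation(1))
    fix \<omega> assume "\<omega> \<in> space (P x)"
    then have "?A \<omega> \<le> L / \<epsilon> * t" using Ab[of \<omega>] by (simp add: space_P abs_le_iff)
    then show "\<bar>exp (?A \<omega>) * w (Y t \<omega>)\<bar> \<le> exp (L / \<epsilon> * t) * W"
      unfolding abs_mult using w0[of "Y t \<omega>"] w(2)[of "Y t \<omega>"] by (intro mult_mono) auto
  qed measurable
  have "measure (P x) ?S = (\<integral>\<omega>. indicator ?S \<omega> \<partial>P x)"
    by (simp add: space_P Int_absorb2)
  also have "\<dots> \<le> (\<integral>\<omega>. exp (- a * t) / \<epsilon> * (exp (?A \<omega>) * w (Y t \<omega>)) \<partial>P x)"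
  proof (rule integral_mono)
    fix \<omega> assume \<omega>: "\<omega> \<in> space (P x)"
    show "indicator ?S \<omega> \<le> exp (- a * t) / \<epsilon> * (exp (?A \<omega>) * w (Y t \<omega>))"
    proof (cases "\<omega> \<in> ?S")
      case True
      then have "a < (\<integral>y. - g y / w y \<partial>occupation_measure X t \<omega>)"
        and "prob_space (occupation_measure X t \<omega>)" using N by auto
      then have "a < (1 / t) * ?A \<omega>"
        using integral_occupation_measure[of "\<lambda>y. - g y / w y" t \<omega>] \<omega> t by (simp add: space_P)
      then have "a * t < ?A \<omega>" using t by (simp only: pos_less_divide_eq mult_1_left times_divide_eq_left)
      then have "1 * \<epsilon> \<le> exp (- a * t + ?A \<omega>) * w (Y t \<omega>)"
        using w(1)[of "Y t \<omega>"] \<epsilon> by (intro mult_mono) auto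
      then show ?thesis using True \<epsilon> by (simp add: exp_add[symmetric] field_simps)
    next
      case False
      then show ?thesis using w0[of "Y t \<omega>"] \<epsilon> by simp
    qed
  next
    show "integrable (P x) (\<lambda>\<omega>. indicator ?S \<omega> :: real)"
      by (rule bounded_expectation(1)[where B=1]) (auto split: split_indicator)
  qed (use int in simp)
  also have "\<dots> = exp (- a * t) / \<epsilon> * w x"
    using feynman_kac[OF assms(1,2) w \<epsilon> g gen, of t x] t by simp
  finally show ?thesis by simp
qed

subsection \<open>Resolvents and thin sets\<close>

text \<open>The integrand lies between 0 and the exponential density, which has mass 1. A
  nonnegative integrable function has integral 0 exactly when it vanishes almost everywhere.\<close>

lemma
  assumes B [measurable]: "B \<in> sets borel"
  shows resolvent_measurable: "resolvent p (indicator B) \<in> borel_measurable borel"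
    and resolvent_nonneg: "0 \<le> resolvent p (indicator B) x"
    and resolvent_le_1: "resolvent p (indicator B) x \<le> 1"
    and resolvent_eq_0_iff: "resolvent p (indicator B) x = 0
      \<longleftrightarrow> (AE t in lborel. 0 \<le> t \<longrightarrow> q t (indicator B) x = 0)"
proof -
  let ?f = "\<lambda>x t. (indicator {0..} t :: real) *\<^sub>R (exp (- t) * q t (indicator B) x)"
  have R: "resolvent p (indicator B) x = (\<integral>t. ?f x t \<partial>lborel)" for x
    unfolding resolvent_def set_lebesgue_integral_def
    by (intro Bochner_Integration.integral_cong) (auto simp: q_def max_def split: split_indicator)
  show "resolvent p (indicator B) \<in> borel_measurable borel"
    unfolding R[abs_def] by (rule lborel.borel_measurable_lebesgue_integral) measurable
  have q0: "0 \<le> q t (indicator B) x" for t x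
    by (simp add: q_def trans_op_def integral_nonneg_AE)
  have q1: "q t (indicator B) x \<le> 1" for t x
    using q_bound[of "indicator B" 1 t x] by (auto simp: abs_le_iff split: split_indicator)
  have e: "has_bochner_integral lborel (\<lambda>t::real. exp (- t) * indicator {0..} t) 1"
    using has_bochner_integral_I0i_power_exp_m'[of 0] by simp
  have int: "integrable lborel (?f x)" for x
    by (rule Bochner_Integration.integrable_bound[OF integrable.intros[OF e]])
       (use q0 q1 in \<open>auto simp: abs_mult split: split_indicator\<close>)
  show "0 \<le> resolvent p (indicator B) x"
    unfolding R by (intro integral_nonneg_AE) (simp add: q0)
  have "(\<integral>t. ?f x t \<partial>lborel) \<le> (\<integral>t. exp (- t) * indicator {0..} t \<partial>lborel)"
    by (rule integral_mono[OF int integrable.intros[OF e]])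
       (use q1 in \<open>auto split: split_indicator\<close>)
  also have "\<dots> = 1" using e by (rule has_bochner_integral_integral_eq)
  finally show "resolvent p (indicator B) x \<le> 1" unfolding R .
  have "resolvent p (indicator B) x = 0 \<longleftrightarrow> (AE t in lborel. ?f x t = 0)"
    unfolding R using int q0 by (intro integral_nonneg_eq_0_iff_AE) auto
  also have "\<dots> \<longleftrightarrow> (AE t in lborel. 0 \<le> t \<longrightarrow> q t (indicator B) x = 0)"
    by (intro AE_cong) (auto split: split_indicator)
  finally show "resolvent p (indicator B) x = 0
      \<longleftrightarrow> (AE t in lborel. 0 \<le> t \<longrightarrow> q t (indicator B) x = 0)" .
qed

text \<open>A vanishing resolvent says that \<open>Y s\<close> avoids \<open>B\<close> almost
  surely, for almost every \<open>s\<close>. Exchanging the two quantifiers, almost every path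
  spends Lebesgue-null time in \<open>B\<close>, so its occupation measure cannot lie in
  \<open>N\<close>.\<close>

lemma occupation_null:
  assumes B [measurable]: "B \<in> sets borel" and "resolvent p (indicator B) x = 0" and t: "0 < t"
    and N: "\<And>\<nu>. \<nu> \<in> N \<Longrightarrow> prob_space \<nu> \<and> (\<integral>y. indicator B y \<partial>\<nu>) \<noteq> (0::real)"
  shows "measure (P x) {\<omega>\<in>space M. occupation_measure X t \<omega> \<in> N} = 0"
    (is "measure _ ?S = 0")
proof -
  interpret prob_space "P x" by (rule prob_space_P)
  interpret pair_sigma_finite lborel "P x"
    by (simp add: pair_sigma_finite_def lborel.sigma_finite_measure_axioms prob_space_imp_sigma_finite prob_space_P)
  have "AE s in lborel. 0 \<le> s \<longrightarrow> q s (indicator B) x = 0"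
    using assms by (simp add: resolvent_eq_0_iff)
  then have "AE s in lborel. AE \<omega> in P x. 0 \<le> s \<longrightarrow> Y s \<omega> \<notin> B"
  proof eventually_elim
    case (elim s)
    show ?case
    proof (cases "0 \<le> s")
      case True
      have "(\<integral>\<omega>. indicator B (Y s \<omega>) \<partial>P x) = (0::real)"
        using elim True by (subst expectation_Y[where B=1]) (auto split: split_indicator)
      moreover have "integrable (P x) (\<lambda>\<omega>. indicator B (Y s \<omega>) :: real)"
        by (rule bounded_expectation(1)[where B=1]) (auto split: split_indicator)
      ultimately have "AE \<omega> in P x. indicator B (Y s \<omega>) = (0::real)"
        by (subst (asm) integral_nonneg_eq_0_iff_AE) auto
      then show ?thesis by (rule eventually_mono) (auto simp: indicator_def split: if_splits)
    qed simp
  qed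
  then have "AE \<omega> in P x. AE s in lborel. 0 \<le> s \<longrightarrow> Y s \<omega> \<notin> B"
    by (subst (asm) AE_commute) measurable
  then have "AE \<omega> in P x. \<omega> \<notin> ?S"
    using AE_space
  proof eventually_elim
    case (elim \<omega>)
    have "(LBINT s:{0..t}. indicator B (Y s \<omega>)) = (0::real)"
      unfolding set_lebesgue_integral_def
      by (rule integral_eq_zero_AE) (use elim(1) in \<open>eventually_elim, auto split: split_indicator\<close>)
    then have "(\<integral>y. indicator B y \<partial>occupation_measure X t \<omega>) = (0::real)"
      if "prob_space (occupation_measure X t \<omega>)"
      using integral_occupation_measure[of "indicator B", OF _ t _ that] elim(2)
      by (simp only: space_P borel_measurable_indicator B mult_zero_right)
    then show ?case using N by blast
  qed
  \<comment> \<open>Either alternative makes \<open>measure\<close> equal to 0, so the event need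
    not be measurable.\<close>
  then have "?S \<in> null_sets (P x) \<or> ?S \<notin> sets (P x)"
    using AE_iff_null_sets[of ?S "P x"] by (cases "?S \<in> sets (P x)") auto
  then show ?thesis by (auto simp: measure_eq_0_null_sets measure_notin_sets)
qed

text \<open>The indicator of \<open>B\<close> and the zero function are the same element of L2, and
  \<open>T t\<close> respects almost everywhere equality; hence \<open>p_t 1_B = 0\<close> holds
  \<open>m\<close>-a.e. for each fixed \<open>t \<ge> 0\<close>. Exchanging the null sets in
  \<open>t\<close> and \<open>x\<close> gives the claim.\<close>

lemma AE_resolvent_0:
  assumes "semigroup_represented m p T" "strongly_continuous_L2_semigroup m T"
    and [measurable_cong]: "sets m = sets borel" and "sigma_finite_measure m"
    and B [measurable]: "B \<in> sets borel" and "emeasure m B = 0"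
  shows "AE x in m. resolvent p (indicator B) x = 0"
proof -
  interpret pair_sigma_finite lborel m
    by (simp add: pair_sigma_finite_def lborel.sigma_finite_measure_axioms assms(4))
  have B0: "AE x in m. indicator B x = (0::real)"
    using assms(5,6) by (intro AE_I[where N=B]) (auto simp: assms(3) split: split_indicator_asm)
  have L2: "indicator B \<in> L2_set m" "(\<lambda>_. 0) \<in> L2_set m"
  proof -
    have "integrable m (\<lambda>x. (indicator B x)\<^sup>2 :: real)"
      using B0 by (subst integrable_cong_AE[where g="\<lambda>_. 0"]) (auto elim: eventually_mono)
    then show "indicator B \<in> L2_set m" by (simp add: L2_set_def)
  qed (simp add: L2_set_def)
  have "AE t in lborel. AE x in m. 0 \<le> t \<longrightarrow> q t (indicator B) x = 0"
  proof (rule AE_I2)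
    fix t :: real
    show "AE x in m. 0 \<le> t \<longrightarrow> q t (indicator B) x = 0"
    proof (cases "0 \<le> t")
      case t: True
      have rep: "AE x in m. trans_op p t f x = T t f x"
        if "f \<in> borel_measurable borel" "bounded (range f)" "integrable m (\<lambda>x. (f x)\<^sup>2)" for f
        using assms(1) t that unfolding semigroup_represented_def by blast
      have bdd: "bounded (range (indicator B :: 'a \<Rightarrow> real))"
        by (rule boundedI[where B=1]) (auto split: split_indicator)
      have "AE x in m. trans_op p t (indicator B) x = T t (indicator B) x"
        using L2(1) by (intro rep bdd) (auto simp: L2_set_def)
      moreover have "AE x in m. trans_op p t (\<lambda>_. 0) x = T t (\<lambda>_. 0) x"
        by (rule rep) auto
      moreover have "\<forall>t\<ge>0. \<forall>f\<in>L2_set m. \<forall>g\<in>L2_set m.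
          (AE x in m. f x = g x) \<longrightarrow> (AE x in m. T t f x = T t g x)"
        using assms(2) unfolding strongly_continuous_L2_semigroup_def by (elim conjE)
      from this[rule_format, OF t L2 B0]
      have "AE x in m. T t (indicator B) x = T t (\<lambda>_. 0) x" .
      ultimately show ?thesis
        by eventually_elim (use t in \<open>simp add: q_def max_def trans_op_def\<close>)
    qed simp
  qed
  then have "AE x in m. AE t in lborel. 0 \<le> t \<longrightarrow> q t (indicator B) x = 0"
    by (subst (asm) AE_commute) measurable
  then show ?thesis by (simp add: resolvent_eq_0_iff[OF B])
qed

text \<open>If \<open>p_h R 1_B\<close> vanishes at \<open>x\<close>, then \<open>R 1_B = 0\<close>
  almost everywhere for \<open>p h x\<close>, and the semigroup law gives
  \<open>p_t 1_B (x) = 0\<close> for almost every \<open>t \<ge> h\<close>. Taking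
  \<open>h = 1 / (n + 1)\<close> for all \<open>n\<close> covers almost every positive time.\<close>

lemma m_thin_capacity_0:
  assumes "semigroup_represented m p T" "strongly_continuous_L2_semigroup m T"
    and "sets m = sets borel" and "sigma_finite_measure m"
    and "m_thin p m N" and "capacity cap" and "capacity_condition p m cap"
  shows "cap N = 0"
proof -
  obtain B where B [measurable]: "B \<in> sets borel" and "emeasure m B = 0"
    and N: "N \<in> sets borel" "N \<subseteq> {x. 0 < resolvent p (indicator B) x}"
    using assms(5) by (auto simp: m_thin_def)
  let ?R = "resolvent p (indicator B)"
  note [measurable] = resolvent_measurable[OF B]
  have Rb: "\<bar>?R x\<bar> \<le> 1" for x
    using resolvent_nonneg[OF B] resolvent_le_1[OF B] by simp
  have "\<exists>Z\<in>sets borel. cap Z = 0 \<and> (\<forall>x. x \<notin> Z \<longrightarrow> trans_op p h ?R x = 0)" if "0 < h" for h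
  proof -
    have "bounded (range ?R)" using Rb by (auto intro!: boundedI[where B=1])
    then show ?thesis
      using assms(7) that AE_resolvent_0[OF assms(1-4) B \<open>emeasure m B = 0\<close>] resolvent_measurable[OF B]
      unfolding capacity_condition_def by blast
  qed
  then have "\<forall>n. \<exists>Z\<in>sets borel. cap Z = 0 \<and> (\<forall>x. x \<notin> Z \<longrightarrow> trans_op p (1 / real (Suc n)) ?R x = 0)"
    by auto
  then obtain Z where Z: "\<And>n. Z n \<in> sets borel" "\<And>n. cap (Z n) = 0"
    "\<And>n x. x \<notin> Z n \<Longrightarrow> trans_op p (1 / real (Suc n)) ?R x = 0"
    by metis
  have "?R x = 0" if x: "x \<notin> (\<Union>n. Z n)" for x
  proof -
    have "AE t in lborel. h \<le> t \<longrightarrow> q t (indicator B) x = 0" if h: "h = 1 / real (Suc n)" for h n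
    proof -
      have "0 \<le> h" using h by simp
      interpret prob_space "p h x" using \<open>0 \<le> h\<close> by (rule prob_space_p)
      interpret pair_sigma_finite lborel "p h x"
        by (simp add: pair_sigma_finite_def lborel.sigma_finite_measure_axioms prob_space_imp_sigma_finite
            prob_space_p \<open>0 \<le> h\<close>)
      note [measurable_cong] = sets_p[OF \<open>0 \<le> h\<close>]
      have "(\<integral>y. ?R y \<partial>p h x) = 0" using Z(3)[of x n] x h by (auto simp: trans_op_def)
      moreover have "integrable (p h x) ?R"
        by (rule bounded_expectation(1)[where B=1]) (use Rb in auto)
      ultimately have "AE y in p h x. ?R y = 0"
        using resolvent_nonneg[OF B] by (subst (asm) integral_nonneg_eq_0_iff_AE) auto
      then have "AE y in p h x. AE s in lborel. 0 \<le> s \<longrightarrow> q s (indicator B) y = 0"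
        by (simp add: resolvent_eq_0_iff[OF B])
      then have "AE s in lborel. AE y in p h x. 0 \<le> s \<longrightarrow> q s (indicator B) y = 0"
        by (subst AE_commute) measurable
      then have "AE s in lborel. 0 \<le> s \<longrightarrow> q (h + s) (indicator B) x = 0"
      proof eventually_elim
        case (elim s)
        show ?case
        proof
          assume s: "0 \<le> s"
          have "q (h + s) (indicator B) x = q h (q s (indicator B)) x"
            using \<open>0 \<le> h\<close> s by (intro q_semigroup[symmetric, where B=1]) (auto split: split_indicator)
          also have "\<dots> = (\<integral>y. q s (indicator B) y \<partial>p h x)"
            using \<open>0 \<le> h\<close> by (simp add: q_def[of h] trans_op_def[of p h] max_def)
          also have "\<dots> = 0"
            using elim s by (intro integral_eq_zero_AE) (auto elim: eventually_mono)
          finally show "q (h + s) (indicator B) x = 0" .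
        qed
      qed
      \<comment> \<open>Substituting \<open>t = h + s\<close>; Lebesgue measure is invariant under
        this translation.\<close>
      then have "AE t in distr lborel borel ((+) h). h \<le> t \<longrightarrow> q t (indicator B) x = 0"
        by (subst AE_distr_iff) auto
      then show ?thesis by (subst (asm) lborel_distr_plus)
    qed
    then have "AE t in lborel. \<forall>n. 1 / real (Suc n) \<le> t \<longrightarrow> q t (indicator B) x = 0"
      unfolding AE_all_countable by blast
    \<comment> \<open>Time 0 lies in none of the half-lines starting at \<open>1 / (n + 1)\<close>,
      but it is a null set.\<close>
    moreover have "AE t in lborel. t \<noteq> (0::real)" by (rule AE_lborel_singleton)
    ultimately have "AE t in lborel. 0 \<le> t \<longrightarrow> q t (indicator B) x = 0"
    proof eventually_elim
      case (elim t)
      show ?case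
      proof
        assume "0 \<le> t"
        with elim(2) obtain n where "inverse (real (Suc n)) < t" using reals_Archimedean[of t] by auto
        then show "q t (indicator B) x = 0" using elim(1) by (auto simp: inverse_eq_divide dest!: spec[of _ n])
      qed
    qed
    then show ?thesis by (simp add: resolvent_eq_0_iff[OF B])
  qed
  then have "N \<subseteq> (\<Union>n. Z n)" using N(2) by fastforce
  moreover have "cap (\<Union>n. Z n) = 0" "(\<Union>n. Z n) \<in> sets borel"
    using assms(6) Z by (auto simp: capacity_def)
  ultimately have "cap N \<le> 0" using assms(6) N(1) by (metis capacity_def)
  then show ?thesis by simp
qed

subsection \<open>The upper bound\<close>

text \<open>Off the thin set the probabilities are 0 for every \<open>t > 0\<close>, so the bound
  holds with an arbitrary real \<open>a\<close>.\<close>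

lemma upper_bound_singular:
  assumes "sets m = sets borel" "prob_space \<mu>" "sets \<mu> = sets borel" "\<not> absolutely_continuous m \<mu>"
  shows "\<exists>N\<^sub>\<mu> N. tau_nbhd \<mu> N\<^sub>\<mu> \<and> m_thin p m N \<and>
    (\<forall>x. x \<notin> N \<longrightarrow> Limsup at_top (\<lambda>t::real. ereal (1 / t) *
      elog (measure (P x) {\<omega> \<in> space M. occupation_measure X t \<omega> \<in> N\<^sub>\<mu>})) \<le> ereal (- a))"
proof -
  interpret \<mu>: prob_space \<mu> by fact
  obtain B where "B \<in> null_sets m" "B \<notin> null_sets \<mu>"
    using assms(4) by (auto simp: absolutely_continuous_def)
  then have B [measurable]: "B \<in> sets borel" and "emeasure m B = 0" and "measure \<mu> B \<noteq> 0"
    using assms(1,3) by (auto simp: null_sets_def \<mu>.emeasure_eq_measure)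
  \<comment> \<open>The radius equals the mass that \<open>\<mu>\<close> gives to \<open>B\<close>,
    so every measure in the neighborhood still charges \<open>B\<close>.\<close>
  define b where "b = (\<integral>y. indicator B y \<partial>\<mu> :: real)"
  have b: "0 < b"
    using \<open>measure \<mu> B \<noteq> 0\<close> B assms(3) sets_eq_imp_space_eq[OF assms(3)]
    by (simp add: b_def zero_less_measure_iff)
  define N\<mu> where "N\<mu> = {\<nu>. prob_space \<nu> \<and> sets \<nu> = sets borel \<and>
    (\<forall>j\<in>{1..1::nat}. \<bar>(\<integral>y. indicator B y \<partial>\<nu>) - (\<integral>y. indicator B y \<partial>\<mu>)\<bar> < b)}"
  define N where "N = {x. 0 < resolvent p (indicator B) x}"
  have "tau_nbhd \<mu> N\<mu>"
    unfolding tau_nbhd_def N\<mu>_def using b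
    by (intro exI[of _ b] conjI exI[of _ "1::nat"] exI[of _ "\<lambda>_. indicator B"] refl)
       (auto intro!: boundedI[where B=1] split: split_indicator)
  moreover have "m_thin p m N"
    unfolding m_thin_def N_def
    using resolvent_measurable[OF B] B \<open>emeasure m B = 0\<close> by (auto intro!: borel_measurable_less)
  moreover have "Limsup at_top (\<lambda>t::real. ereal (1 / t) *
      elog (measure (P x) {\<omega> \<in> space M. occupation_measure X t \<omega> \<in> N\<mu>})) \<le> ereal (- a)"
    if "x \<notin> N" for x
  proof (rule Limsup_elog_le[where c=1])
    have R: "resolvent p (indicator B) x = 0"
      using that resolvent_nonneg[OF B, of x] by (simp add: N_def)
    have "prob_space \<nu> \<and> (\<integral>y. indicator B y \<partial>\<nu>) \<noteq> (0::real)" if "\<nu> \<in> N\<mu>" for \<nu>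
      using that unfolding N\<mu>_def b_def by force
    from occupation_null[OF B R _ this]
    show "0 \<le> measure (P x) {\<omega> \<in> space M. occupation_measure X t \<omega> \<in> N\<mu>} \<and>
      measure (P x) {\<omega> \<in> space M. occupation_measure X t \<omega> \<in> N\<mu>} \<le> exp (- a * t) * 1" if "0 < t" for t
      using that by simp
  qed simp
  ultimately show ?thesis by blast
qed

text \<open>A pair from \<open>D1_pairs\<close> whose integral lies below \<open>-a\<close> supplies
  the single test function \<open>V\<close> that defines the neighborhood. The Chebyshev bound holds
  from every starting point, hence no exceptional set.\<close>

lemma upper_bound_I_hat:
  assumes "ereal a < I_hat p m \<mu>"
  shows "\<exists>N\<^sub>\<mu>. tau_nbhd \<mu> N\<^sub>\<mu> \<and>
    (\<forall>x. Limsup at_top (\<lambda>t::real. ereal (1 / t) *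
      elog (measure (P x) {\<omega> \<in> space M. occupation_measure X t \<omega> \<in> N\<^sub>\<mu>})) \<le> ereal (- a))"
proof -
  have "Inf {ereal (\<integral>x. Lv x / (v x + \<epsilon>) \<partial>\<mu>) | v Lv \<epsilon>. (v, Lv) \<in> D1_pairs p m \<and> \<epsilon> > 0} < ereal (- a)"
    using assms unfolding I_hat_def by (subst (asm) ereal_less_uminus_reorder) simp
  then obtain z where "z < ereal (- a)"
    and "z \<in> {ereal (\<integral>x. Lv x / (v x + \<epsilon>) \<partial>\<mu>) | v Lv \<epsilon>. (v, Lv) \<in> D1_pairs p m \<and> \<epsilon> > 0}"
    unfolding Inf_less_iff by blast
  then obtain v Lv \<epsilon> where D1: "(v, Lv) \<in> D1_pairs p m" and \<epsilon>: "0 < \<epsilon>"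
    and less: "(\<integral>x. Lv x / (v x + \<epsilon>) \<partial>\<mu>) < - a"
    by (smt (verit) mem_Collect_eq ereal_less_eq(3) linorder_not_le)
  from D1 obtain u s \<eta> where u: "u \<in> D_set m" and s: "0 < s" and \<eta>: "0 \<le> \<eta>"
    and v: "v = (\<lambda>x. (1 / s) * (LBINT r=0..s. trans_op p r (trans_op p \<eta> u) x))"
    and Lv: "Lv = (\<lambda>x. (1 / s) * (trans_op p s (trans_op p \<eta> u) x - trans_op p \<eta> u x))"
    unfolding D1_pairs_def mem_Collect_eq prod.inject by (elim exE conjE) (rule that)
  define u' where "u' = q \<eta> u"
  have um: "u \<in> borel_measurable borel" and u0: "0 \<le> u y" for y
    using u by (auto simp: D_set_def)
  have "bounded (range u)" using u by (simp add: D_set_def)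
  then obtain C where uC: "\<bar>u y\<bar> \<le> C" for y
    unfolding bounded_iff real_norm_def by blast
  have u'm: "u' \<in> borel_measurable borel" unfolding u'_def using um by measurable
  have u'C: "\<bar>u' y\<bar> \<le> C" for y unfolding u'_def by (rule q_bound[OF um uC])
  have u'0: "0 \<le> u' y" for y
    using u0 by (simp add: u'_def q_def trans_op_def integral_nonneg_AE)
  have u'_eq: "trans_op p \<eta> u = u'" using \<eta> by (simp add: u'_def q_def max_def)
  have v_eq: "v = (\<lambda>x. (1 / s) * (LBINT r:{0..s}. q r u' x))"
    unfolding v u'_eq using s
    by (subst zero_ereal_def, subst interval_integral_Icc)
       (auto intro!: set_lebesgue_integral_cong simp: q_def max_def fun_eq_iff)
  have Lv_eq: "Lv = (\<lambda>x. (1 / s) * (q s u' x - u' x))"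
    unfolding Lv u'_eq using s by (simp add: q_def max_def)
  have gen: "v \<in> borel_measurable borel" "\<bar>v y\<bar> \<le> C"
    "Lv \<in> borel_measurable borel" "\<bar>Lv y\<bar> \<le> (1 / s) * (2 * C)"
    "0 \<le> h \<Longrightarrow> q h v y - v y = (LBINT r:{0..h}. q r Lv y)" for y h
    unfolding v_eq Lv_eq by (rule D1_generator[OF u'm u'C s]; assumption)+
  note [measurable] = gen(1,3)
  have v0: "0 \<le> v y" for y
    unfolding v_eq set_lebesgue_integral_def using s u'0
    by (auto intro!: mult_nonneg_nonneg integral_nonneg_AE simp: q_def trans_op_def)
  \<comment> \<open>Adding \<open>\<epsilon>\<close> bounds the function away from 0 and leaves the
    generator identity unchanged, because the operators \<open>q h\<close> preserve
    constants.\<close>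
  define w where "w y = v y + \<epsilon>" for y
  have [measurable]: "w \<in> borel_measurable borel" unfolding w_def by measurable
  have w: "\<epsilon> \<le> w y" "w y \<le> C + \<epsilon>" for y
    using v0[of y] abs_le_D1[OF gen(2)[of y]] by (auto simp: w_def)
  have w_gen: "q h w y - w y = (LBINT r:{0..h}. q r Lv y)" if "0 \<le> h" for h y
    unfolding w_def[abs_def] using gen(5)[OF that] by (simp add: q_add_const[OF gen(1,2)])
  define V where "V y = - Lv y / w y" for y
  have [measurable]: "V \<in> borel_measurable borel" unfolding V_def by measurable
  have "\<bar>V y\<bar> \<le> (1 / s) * (2 * C) / \<epsilon>" for y
    unfolding V_def abs_divide using gen(4)[of y] w(1)[of y] \<epsilon> order_trans[OF abs_ge_zero gen(4)]
    by (intro frac_le) auto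
  then have Vb: "bounded (range V)" by (auto intro!: boundedI)
  \<comment> \<open>The margin by which the integral of \<open>V\<close> against
    \<open>\<mu>\<close> exceeds \<open>a\<close>; within this radius the integral stays above
    \<open>a\<close>.\<close>
  define b where "b = (\<integral>y. V y \<partial>\<mu>) - a"
  have b: "0 < b" using less by (simp add: b_def V_def w_def)
  define N where "N = {\<nu>. prob_space \<nu> \<and> sets \<nu> = sets borel \<and>
    (\<forall>j\<in>{1..1::nat}. \<bar>(\<integral>y. V y \<partial>\<nu>) - (\<integral>y. V y \<partial>\<mu>)\<bar> < b)}"
  have "tau_nbhd \<mu> N"
    unfolding tau_nbhd_def N_def using b Vb
    by (intro exI[of _ b] conjI exI[of _ "1::nat"] exI[of _ "\<lambda>_. V"] refl) auto
  moreover have "Limsup at_top (\<lambda>t::real. ereal (1 / t) *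
      elog (measure (P x) {\<omega> \<in> space M. occupation_measure X t \<omega> \<in> N})) \<le> ereal (- a)" for x
  proof (rule Limsup_elog_le)
    show "0 < w x / \<epsilon>" using w(1)[of x] \<epsilon> by (intro divide_pos_pos) auto
    have N: "prob_space \<nu> \<and> a < (\<integral>y. - Lv y / w y \<partial>\<nu>)" if "\<nu> \<in> N" for \<nu>
      using that unfolding N_def b_def V_def by force
    show "0 \<le> measure (P x) {\<omega> \<in> space M. occupation_measure X t \<omega> \<in> N} \<and>
      measure (P x) {\<omega> \<in> space M. occupation_measure X t \<omega> \<in> N} \<le> exp (- a * t) * (w x / \<epsilon>)" if "0 < t" for t
      using exponential_chebyshev[OF _ _ w \<epsilon> gen(4) w_gen that N] by simp
  qed
  ultimately show ?thesis by blast
qed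

end

theorem theorem1p11:
  fixes m :: "'a::topological_space measure"
    and p :: "real \<Rightarrow> 'a \<Rightarrow> 'a measure"
    and T :: "real \<Rightarrow> ('a \<Rightarrow> real) \<Rightarrow> ('a \<Rightarrow> real)"
    and M :: "'w measure"
    and X :: "real \<Rightarrow> 'w \<Rightarrow> 'a"
    and P :: "'a \<Rightarrow> 'w measure"
    and \<mu> :: "'a measure"
    and a :: real
  assumes lusin: "lusin_topology (euclidean :: 'a topology)"
    and borel_gen: "sets (borel :: 'a measure) =
          sigma_sets UNIV {f -` U | (f :: 'a \<Rightarrow> real) U. continuous_on UNIV f \<and> open U}"
    and m_sets: "sets m = sets borel"
    and m_sfin: "sigma_finite_measure m"
    and m_pos: "emeasure m UNIV > 0"
    and p_trans: "transition_function p"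
    and T_sg: "strongly_continuous_L2_semigroup m T"
    and T_rep: "semigroup_represented m p T"
    and markov: "markov_process M X P p"
    and mu_prob: "prob_space \<mu>"
    and mu_sets: "sets \<mu> = sets borel"
    and a_less: "ereal a < I_rate p m \<mu>"
  shows "\<exists>N\<^sub>\<mu> N. tau_nbhd \<mu> N\<^sub>\<mu> \<and> m_thin p m N \<and>
           (\<forall>x. x \<notin> N \<longrightarrow>
              Limsup at_top (\<lambda>t::real. ereal (1 / t) *
                 elog (measure (P x) {\<omega> \<in> space M. occupation_measure X t \<omega> \<in> N\<^sub>\<mu>}))
              \<le> ereal (- a)) \<and>
           (\<forall>cap. capacity cap \<and> capacity_condition p m cap \<longrightarrow> cap N = 0)"
proof -
  interpret markov_setting p M X P by unfold_locales (fact p_trans, fact markov)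
  have "\<exists>N\<^sub>\<mu> N. tau_nbhd \<mu> N\<^sub>\<mu> \<and> m_thin p m N \<and>
    (\<forall>x. x \<notin> N \<longrightarrow> Limsup at_top (\<lambda>t::real. ereal (1 / t) *
      elog (measure (P x) {\<omega> \<in> space M. occupation_measure X t \<omega> \<in> N\<^sub>\<mu>})) \<le> ereal (- a))"
  proof (cases "absolutely_continuous m \<mu>")
    case True
    then have "ereal a < I_hat p m \<mu>" using a_less by (simp add: I_rate_def)
    moreover have "m_thin p m {}" by (auto simp: m_thin_def)
    ultimately show ?thesis using upper_bound_I_hat by blast
  next
    case False
    then show ?thesis by (rule upper_bound_singular[OF m_sets mu_prob mu_sets])
  qed
  \<comment> \<open>The capacity claim follows from thinness of \<open>N\<close> alone, so both
    cases are settled at once.\<close>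
  then show ?thesis using m_thin_capacity_0[OF T_rep T_sg m_sets m_sfin] by blast
qed

end
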